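(* Let $\beta>0$ be a real constant and let $V\in L^\infty(\mathcal D)$ with $V\ge0$. For any $\phi\in H^2(\mathcal D)$ satisfying periodic boundary conditions and $\|\phi\|_2=1$, $$\lim_{\tau\to0^+}E^{2,\tau}(\phi)=E(\phi).$$
   Context: $\mathcal D\subset\mathbb R^d$, $d\in\{1,2,3\}$, is a bounded domain (an interval for $d=1$, a rectangle for $d=2$, a box for $d=3$), with periodic boundary conditions imposed on all functions. Functions $\phi$ are complex-valued, and $\|\cdot\|_2$ is the norm of $L^2(\mathcal D)$. $e^{t\Delta}$, $t\ge 0$, denotes the heat semigroup on $L^2(\mathcal D)$ generated by the Laplacian with periodic boundary conditions. The Gross--Pitaevskii energy is $$E(\phi)=\int_{\mathcal D}\Big(\frac12|\nabla\phi|^2+V(x)|\phi|^2+\frac\beta2|\phi|^4\Big)\,dx,$$ and for $\tau>0$ the second-order relaxed energy is $$E^{2,\tau}(\phi)=\frac3{2\tau}+\int_{\mathcal D}\Big[\frac1{2\tau}\Big(\big|e^{\frac\tau2\Delta}\phi\big|^2-4\big|e^{\frac\tau4\Delta}\phi\big|^2\Big)+V(x)|\phi|^2+\frac\beta2|\phi|^4\Big]\,dx.$$ *)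

theory Defs
  imports "HOL-Analysis.Analysis"
begin

section \<open>Square-integrable functions\<close>

text \<open>
  Elements of \<open>L\<^sup>2(D)\<close> are represented by functions on the whole space; only their values
  almost everywhere on \<open>D\<close> matter.
\<close>

definition L2 :: "'a::euclidean_space set \<Rightarrow> ('a \<Rightarrow> complex) set" where
  "L2 D = {u. u \<in> borel_measurable (lebesgue_on D) \<and>
              integrable (lebesgue_on D) (\<lambda>x. (cmod (u x))\<^sup>2)}"

definition L2norm :: "'a::euclidean_space set \<Rightarrow> ('a \<Rightarrow> complex) \<Rightarrow> real" where
  "L2norm D u = sqrt (\<integral>x. (cmod (u x))\<^sup>2 \<partial>lebesgue_on D)"

definition Linf :: "'a::euclidean_space set \<Rightarrow> ('a \<Rightarrow> real) set" where
  "Linf D = {V. V \<in> borel_measurable (lebesgue_on D) \<and>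
                (\<exists>M. AE x in lebesgue_on D. \<bar>V x\<bar> \<le> M)}"


section \<open>Smooth functions\<close>

definition partial_deriv :: "'a::euclidean_space \<Rightarrow> ('a \<Rightarrow> complex) \<Rightarrow> 'a \<Rightarrow> complex" where
  "partial_deriv i f x = frechet_derivative f (at x) i"

primrec Ck :: "nat \<Rightarrow> ('a::euclidean_space \<Rightarrow> complex) \<Rightarrow> bool" where
  "Ck 0 f \<longleftrightarrow> continuous_on UNIV f"
| "Ck (Suc k) f \<longleftrightarrow> (\<forall>x. f differentiable (at x)) \<and> (\<forall>i\<in>Basis. Ck k (partial_deriv i f))"

definition smooth :: "('a::euclidean_space \<Rightarrow> complex) \<Rightarrow> bool" where
  "smooth f \<longleftrightarrow> (\<forall>k. Ck k f)"

definition test_function :: "'a::euclidean_space set \<Rightarrow> ('a \<Rightarrow> complex) \<Rightarrow> bool" where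
  "test_function D \<eta> \<longleftrightarrow>
     smooth \<eta> \<and> (\<exists>K. compact K \<and> K \<subseteq> D \<and> (\<forall>x. x \<notin> K \<longrightarrow> \<eta> x = 0))"

definition box_periodic :: "'a::euclidean_space \<Rightarrow> 'a \<Rightarrow> ('a \<Rightarrow> complex) \<Rightarrow> bool" where
  "box_periodic a b \<eta> \<longleftrightarrow> (\<forall>x. \<forall>i\<in>Basis. \<eta> (x + ((b - a) \<bullet> i) *\<^sub>R i) = \<eta> x)"


section \<open>Sobolev spaces and periodic boundary conditions\<close>

definition is_weak_deriv ::
    "'a::euclidean_space set \<Rightarrow> 'a \<Rightarrow> ('a \<Rightarrow> complex) \<Rightarrow> ('a \<Rightarrow> complex) \<Rightarrow> bool" where
  "is_weak_deriv D i u g \<longleftrightarrow>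
     (\<forall>\<eta>. test_function D \<eta> \<longrightarrow>
        (\<integral>x. u x * partial_deriv i \<eta> x \<partial>lebesgue_on D) = - (\<integral>x. g x * \<eta> x \<partial>lebesgue_on D))"

definition H1 :: "'a::euclidean_space set \<Rightarrow> ('a \<Rightarrow> complex) set" where
  "H1 D = {u \<in> L2 D. \<forall>i\<in>Basis. \<exists>g\<in>L2 D. is_weak_deriv D i u g}"

text \<open>A representative of the weak derivative in direction \<open>i\<close>, meaningful for \<open>u \<in> H1 D\<close>.\<close>

definition weak_deriv ::
    "'a::euclidean_space set \<Rightarrow> 'a \<Rightarrow> ('a \<Rightarrow> complex) \<Rightarrow> 'a \<Rightarrow> complex" where
  "weak_deriv D i u = (SOME g. g \<in> L2 D \<and> is_weak_deriv D i u g)"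

definition H2 :: "'a::euclidean_space set \<Rightarrow> ('a \<Rightarrow> complex) set" where
  "H2 D = {u \<in> H1 D. \<forall>i\<in>Basis. weak_deriv D i u \<in> H1 D}"

text \<open>
  For \<open>u \<in> H\<^sup>1\<close> of the box and \<open>\<eta>\<close> smooth and periodic, Green's formula identifies the
  integral below with the integral of \<open>(u\<^sub>+ - u\<^sub>-) \<eta>\<close> over a face orthogonal to \<open>i\<close>, where
  \<open>u\<^sub>+\<close> and \<open>u\<^sub>-\<close> are the traces of \<open>u\<close> on the two opposite faces.  Its vanishing for all
  \<open>\<eta>\<close> says that these traces agree.
\<close>

definition periodic_traces ::
    "'a::euclidean_space \<Rightarrow> 'a \<Rightarrow> ('a \<Rightarrow> complex) \<Rightarrow> bool" where
  "periodic_traces a b u \<longleftrightarrow>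
     (\<forall>i\<in>Basis. \<forall>\<eta>. smooth \<eta> \<and> box_periodic a b \<eta> \<longrightarrow>
        (\<integral>x. u x * partial_deriv i \<eta> x + weak_deriv (box a b) i u x * \<eta> x
           \<partial>lebesgue_on (box a b)) = 0)"

text \<open>
  For functions in \<open>H\<^sup>2\<close> the periodic boundary conditions concern the function and its first
  derivatives, so that the periodic extension is locally in \<open>H\<^sup>2\<close>.
\<close>

definition periodic_bc :: "'a::euclidean_space \<Rightarrow> 'a \<Rightarrow> ('a \<Rightarrow> complex) \<Rightarrow> bool" where
  "periodic_bc a b u \<longleftrightarrow>
     periodic_traces a b u \<and> (\<forall>i\<in>Basis. periodic_traces a b (weak_deriv (box a b) i u))"


section \<open>The periodic heat semigroup\<close>

definition weak_laplacian ::
    "'a::euclidean_space set \<Rightarrow> ('a \<Rightarrow> complex) \<Rightarrow> 'a \<Rightarrow> complex" where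
  "weak_laplacian D u x = (\<Sum>i\<in>Basis. weak_deriv D i (weak_deriv D i u) x)"

text \<open>
  The graph of the Laplacian on \<open>L\<^sup>2\<close> of the box, with domain the \<open>H\<^sup>2\<close> functions satisfying
  periodic boundary conditions.
\<close>

definition periodic_laplacian ::
    "'a::euclidean_space \<Rightarrow> 'a \<Rightarrow> ('a \<Rightarrow> complex) \<Rightarrow> ('a \<Rightarrow> complex) \<Rightarrow> bool" where
  "periodic_laplacian a b u v \<longleftrightarrow>
     u \<in> H2 (box a b) \<and> periodic_bc a b u \<and>
     (AE x in lebesgue_on (box a b). v x = weak_laplacian (box a b) u x)"

text \<open>
  Strongly continuous semigroups of bounded linear operators on \<open>L\<^sup>2(D)\<close>; identities between
  elements of \<open>L\<^sup>2(D)\<close> are almost everywhere.  Linearity and boundedness make each \<open>S t\<close>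
  well defined on almost-everywhere classes.
\<close>

definition C0_semigroup ::
    "'a::euclidean_space set \<Rightarrow> (real \<Rightarrow> ('a \<Rightarrow> complex) \<Rightarrow> 'a \<Rightarrow> complex) \<Rightarrow> bool" where
  "C0_semigroup D S \<longleftrightarrow>
     (\<forall>t\<ge>0. \<forall>u\<in>L2 D. S t u \<in> L2 D) \<and>
     (\<forall>t\<ge>0. \<forall>u\<in>L2 D. \<forall>v\<in>L2 D.
        AE x in lebesgue_on D. S t (\<lambda>y. u y + v y) x = S t u x + S t v x) \<and>
     (\<forall>t\<ge>0. \<forall>u\<in>L2 D. \<forall>c. AE x in lebesgue_on D. S t (\<lambda>y. c * u y) x = c * S t u x) \<and>
     (\<forall>t\<ge>0. \<exists>C. \<forall>u\<in>L2 D. L2norm D (S t u) \<le> C * L2norm D u) \<and>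
     (\<forall>u\<in>L2 D. AE x in lebesgue_on D. S 0 u x = u x) \<and>
     (\<forall>s\<ge>0. \<forall>t\<ge>0. \<forall>u\<in>L2 D. AE x in lebesgue_on D. S (s + t) u x = S s (S t u) x) \<and>
     (\<forall>u\<in>L2 D. ((\<lambda>t. L2norm D (\<lambda>x. S t u x - u x)) \<longlongrightarrow> 0) (at_right 0))"

text \<open>The graph of the infinitesimal generator of \<open>S\<close>.\<close>

definition generator ::
    "'a::euclidean_space set \<Rightarrow> (real \<Rightarrow> ('a \<Rightarrow> complex) \<Rightarrow> 'a \<Rightarrow> complex) \<Rightarrow>
     ('a \<Rightarrow> complex) \<Rightarrow> ('a \<Rightarrow> complex) \<Rightarrow> bool" where
  "generator D S u v \<longleftrightarrow>
     ((\<lambda>h. L2norm D (\<lambda>x. (S h u x - u x) / of_real h - v x)) \<longlongrightarrow> 0) (at_right 0)"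

text \<open>
  \<open>S t\<close> is the operator \<open>e\<^bsup>t\<Delta>\<^esup>\<close>; the generator determines \<open>S t u\<close> uniquely, almost everywhere,
  for all \<open>t \<ge> 0\<close> and \<open>u \<in> L\<^sup>2\<close>.
\<close>

definition periodic_heat_semigroup ::
    "'a::euclidean_space \<Rightarrow> 'a \<Rightarrow> (real \<Rightarrow> ('a \<Rightarrow> complex) \<Rightarrow> 'a \<Rightarrow> complex) \<Rightarrow> bool" where
  "periodic_heat_semigroup a b S \<longleftrightarrow>
     C0_semigroup (box a b) S \<and>
     (\<forall>u\<in>L2 (box a b). \<forall>v\<in>L2 (box a b).
        generator (box a b) S u v \<longleftrightarrow> periodic_laplacian a b u v)"


section \<open>The energies\<close>

definition GP_energy ::
    "'a::euclidean_space set \<Rightarrow> ('a \<Rightarrow> real) \<Rightarrow> real \<Rightarrow> ('a \<Rightarrow> complex) \<Rightarrow> real" where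
  "GP_energy D V \<beta> \<phi> =
     (\<integral>x. 1 / 2 * (\<Sum>i\<in>Basis. (cmod (weak_deriv D i \<phi> x))\<^sup>2)
           + V x * (cmod (\<phi> x))\<^sup>2 + \<beta> / 2 * (cmod (\<phi> x)) ^ 4 \<partial>lebesgue_on D)"

definition relaxed_energy2 ::
    "'a::euclidean_space set \<Rightarrow> (real \<Rightarrow> ('a \<Rightarrow> complex) \<Rightarrow> 'a \<Rightarrow> complex) \<Rightarrow>
     ('a \<Rightarrow> real) \<Rightarrow> real \<Rightarrow> real \<Rightarrow> ('a \<Rightarrow> complex) \<Rightarrow> real" where
  "relaxed_energy2 D S V \<beta> \<tau> \<phi> =
     3 / (2 * \<tau>) +
     (\<integral>x. 1 / (2 * \<tau>) * ((cmod (S (\<tau> / 2) \<phi> x))\<^sup>2 - 4 * (cmod (S (\<tau> / 4) \<phi> x))\<^sup>2)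
           + V x * (cmod (\<phi> x))\<^sup>2 + \<beta> / 2 * (cmod (\<phi> x)) ^ 4 \<partial>lebesgue_on D)"

end

theory Submission
  imports Defs
begin

text \<open>
  The heat flow leaves \<open>\<phi>\<close> with velocity \<open>\<Delta>\<phi>\<close>, so \<open>\<parallel>e\<^bsup>h\<Delta>\<^esup>\<phi>\<parallel>\<^sup>2\<close> is differentiable from the right at
  \<open>h = 0\<close> with derivative \<open>2 Re \<langle>\<phi>, \<Delta>\<phi>\<rangle>\<close> (\<open>L2norm_sq_derivative\<close>); by Green's formula for periodic
  functions this is \<open>- 2 G\<close>, where \<open>G\<close> is the squared norm of the gradient (\<open>periodic_Green\<close>).  If \<open>d h\<close> denotes
  the difference quotient \<open>(\<parallel>e\<^bsup>h\<Delta>\<^esup>\<phi>\<parallel>\<^sup>2 - 1) / h\<close>, then the part of the relaxed energy that depends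
  on \<open>\<tau>\<close> is \<open>d (\<tau>/2) / 4 - d (\<tau>/4) / 2\<close>: the constant \<open>3 / (2 \<tau>)\<close> cancels the three excess
  multiples of \<open>\<parallel>\<phi>\<parallel>\<^sup>2 = 1\<close>.  Its limit is \<open>- G/2 + G = G/2\<close>, the kinetic energy.

  The potential and quartic terms occur unchanged in both energies, but they can be split off only
  if they are integrable: otherwise the integral of the whole integrand carries no
  information.  For the quartic term this is a Sobolev embedding, and here dimension at most three
  enters: an \<open>H\<^sup>2\<close> function with periodic boundary conditions is essentially bounded
  (\<open>H2_periodic_bounded\<close>).

  Green's formula and the embedding both come from Fourier series on the box.  The definition of
  periodic traces may be tested with plane waves, and this is precisely the statement that a weak
  derivative multiplies the coefficient at frequency \<open>w\<close> by \<open>\<i> w\<^sub>i\<close> (\<open>fcoeff_weak_deriv\<close>).  Green's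
  formula is then Parseval's identity (\<open>Parseval_inner\<close>), and boundedness follows from absolute
  summability of the coefficients, obtained from the Bessel inequality for \<open>\<phi> - \<Delta>\<phi>\<close> and the
  convergence of the sum of \<open>(1 + |w|\<^sup>2)\<^sup>-\<^sup>2\<close> over the frequency lattice (\<open>lattice_sum_bounded\<close>).

  Parseval's identity needs two ingredients.  A function orthogonal to all plane waves vanishes
  almost everywhere (\<open>trig_complete\<close>), because indicators of boxes are bounded pointwise limits of
  trigonometric polynomials.  And a subsequence of the partial sums of a Fourier series converges
  almost everywhere, necessarily to the function itself (\<open>fsum_AE_subsequence\<close>), which is the
  usual argument for completeness of \<open>L\<^sup>2\<close>.
\<close>

section \<open>Square-integrable functions\<close>

lemma L2norm_power2: "(L2norm D u)\<^sup>2 = (\<integral>x. (cmod (u x))\<^sup>2 \<partial>lebesgue_on D)"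
  unfolding L2norm_def by (intro real_sqrt_pow2 integral_nonneg_AE) auto

lemma L2norm_nonneg: "0 \<le> L2norm D u"
  unfolding L2norm_def by (intro real_sqrt_ge_zero integral_nonneg_AE) auto

lemma L2_measurable: "u \<in> L2 D \<Longrightarrow> u \<in> borel_measurable (lebesgue_on D)"
  by (simp add: L2_def)

lemma L2_integrable_power2: "u \<in> L2 D \<Longrightarrow> integrable (lebesgue_on D) (\<lambda>x. (cmod (u x))\<^sup>2)"
  by (simp add: L2_def)

lemma cmod_add_power2_le: "(cmod (x + y))\<^sup>2 \<le> 2 * (cmod x)\<^sup>2 + 2 * (cmod y)\<^sup>2"
proof -
  have "(cmod (x + y))\<^sup>2 \<le> (cmod x + cmod y)\<^sup>2"
    by (intro power_mono norm_triangle_ineq) auto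
  also have "\<dots> \<le> 2 * (cmod x)\<^sup>2 + 2 * (cmod y)\<^sup>2"
    using sum_squares_bound[of "cmod x" "cmod y"] by (simp add: power2_sum)
  finally show ?thesis .
qed

lemma L2_add:
  assumes "u \<in> L2 D" "v \<in> L2 D"
  shows "(\<lambda>x. u x + v x) \<in> L2 D"
proof -
  note [measurable] = assms[THEN L2_measurable]
  have "integrable (lebesgue_on D) (\<lambda>x. 2 * (cmod (u x))\<^sup>2 + 2 * (cmod (v x))\<^sup>2)"
    using assms[THEN L2_integrable_power2] by auto
  then have "integrable (lebesgue_on D) (\<lambda>x. (cmod (u x + v x))\<^sup>2)"
    by (rule Bochner_Integration.integrable_bound) (auto simp: cmod_add_power2_le)
  then show ?thesis
    by (simp add: L2_def)
qed

lemma L2_cmult: "u \<in> L2 D \<Longrightarrow> (\<lambda>x. c * u x) \<in> L2 D"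
  by (auto simp: L2_def norm_mult power_mult_distrib)

lemma L2_diff: "u \<in> L2 D \<Longrightarrow> v \<in> L2 D \<Longrightarrow> (\<lambda>x. u x - v x) \<in> L2 D"
  using L2_add[of u D "\<lambda>x. (-1) * v x"] L2_cmult[of v D "-1"] by simp

lemma L2_cnj: "u \<in> L2 D \<Longrightarrow> (\<lambda>x. cnj (u x)) \<in> L2 D"
  by (auto simp: L2_def intro!: borel_measurable_continuous_on[OF continuous_on_cnj] continuous_intros)

lemma L2_zero: "(\<lambda>x. 0) \<in> L2 D"
  by (simp add: L2_def)

lemma L2_sum: "(\<And>i. i \<in> I \<Longrightarrow> u i \<in> L2 D) \<Longrightarrow> (\<lambda>x. \<Sum>i\<in>I. u i x) \<in> L2 D"
  by (induction I rule: infinite_finite_induct) (auto intro: L2_add L2_zero)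

lemma L2_mult_integrable:
  assumes "u \<in> L2 D" "v \<in> L2 D"
  shows "integrable (lebesgue_on D) (\<lambda>x. u x * v x)"
proof -
  note [measurable] = assms[THEN L2_measurable]
  have "integrable (lebesgue_on D) (\<lambda>x. (cmod (u x))\<^sup>2 + (cmod (v x))\<^sup>2)"
    using assms[THEN L2_integrable_power2] by auto
  then show ?thesis
  proof (rule Bochner_Integration.integrable_bound)
    show "AE x in lebesgue_on D. cmod (u x * v x) \<le> norm ((cmod (u x))\<^sup>2 + (cmod (v x))\<^sup>2)"
    proof (intro AE_I2)
      fix x
      have "2 * (cmod (u x) * cmod (v x)) \<le> (cmod (u x))\<^sup>2 + (cmod (v x))\<^sup>2"
        using sum_squares_bound[of "cmod (u x)" "cmod (v x)"] by simp
      moreover have "0 \<le> cmod (u x) * cmod (v x)"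
        by simp
      ultimately have "cmod (u x) * cmod (v x) \<le> (cmod (u x))\<^sup>2 + (cmod (v x))\<^sup>2"
        by linarith
      then show "cmod (u x * v x) \<le> norm ((cmod (u x))\<^sup>2 + (cmod (v x))\<^sup>2)"
        by (simp add: norm_mult)
    qed
  qed auto
qed

lemma L2_inner_integrable:
  "u \<in> L2 D \<Longrightarrow> v \<in> L2 D \<Longrightarrow> integrable (lebesgue_on D) (\<lambda>x. Re (u x * cnj (v x)))"
  by (intro integrable_Re L2_mult_integrable L2_cnj)

lemma L2_bounded:
  assumes "D \<in> lmeasurable" "u \<in> borel_measurable (lebesgue_on D)"
    and "AE x in lebesgue_on D. cmod (u x) \<le> B"
  shows "u \<in> L2 D"
proof -
  interpret finite_measure "lebesgue_on D"
    using assms(1) by (rule finite_measure_lebesgue_on)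
  note [measurable] = assms(2)
  have "integrable (lebesgue_on D) (\<lambda>x. (cmod (u x))\<^sup>2)"
  proof (rule integrable_const_bound[where B = "B\<^sup>2"])
    show "AE x in lebesgue_on D. norm ((cmod (u x))\<^sup>2) \<le> B\<^sup>2"
      using assms(3) by eventually_elim (auto intro!: power_mono)
  qed measurable
  then show ?thesis
    by (simp add: L2_def)
qed

lemma L2_integrable:
  assumes "D \<in> lmeasurable" "u \<in> L2 D"
  shows "integrable (lebesgue_on D) u"
  using L2_mult_integrable[OF assms(2) L2_bounded[OF assms(1), of "\<lambda>_. 1" 1]] by simp

text \<open>
  The quadratic polynomial \<open>t \<mapsto> \<integral> (|u| - t |v|)\<^sup>2\<close> is nonnegative; evaluate it at its minimum.
\<close>

lemma L2_Cauchy_Schwarz: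
  assumes u: "u \<in> L2 D" and v: "v \<in> L2 D"
  shows "(\<integral>x. cmod (u x) * cmod (v x) \<partial>lebesgue_on D) \<le> L2norm D u * L2norm D v"
proof -
  define P where "P = (\<integral>x. cmod (u x) * cmod (v x) \<partial>lebesgue_on D)"
  have int: "integrable (lebesgue_on D) (\<lambda>x. cmod (u x) * cmod (v x))"
    using integrable_norm[OF L2_mult_integrable[OF u v]] by (simp add: norm_mult)
  have quad: "0 \<le> (L2norm D u)\<^sup>2 - 2 * (t * P) + t\<^sup>2 * (L2norm D v)\<^sup>2" for t
  proof -
    have "0 \<le> (\<integral>x. (cmod (u x) - t * cmod (v x))\<^sup>2 \<partial>lebesgue_on D)"
      by (intro integral_nonneg_AE) auto
    also have "\<dots> = (\<integral>x. (cmod (u x))\<^sup>2 - 2 * (t * (cmod (u x) * cmod (v x))) + t\<^sup>2 * (cmod (v x))\<^sup>2 \<partial>lebesgue_on D)"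
      by (intro Bochner_Integration.integral_cong) (auto simp: power2_diff power_mult_distrib)
    also have "\<dots> = (L2norm D u)\<^sup>2 - 2 * (t * P) + t\<^sup>2 * (L2norm D v)\<^sup>2"
      using int u v by (simp add: L2norm_power2 P_def L2_integrable_power2)
    finally show ?thesis .
  qed
  have "P\<^sup>2 \<le> (L2norm D u * L2norm D v)\<^sup>2"
  proof (cases "L2norm D v = 0")
    case True
    have "P = 0"
    proof (rule ccontr)
      assume "P \<noteq> 0"
      with quad[of "((L2norm D u)\<^sup>2 + 1) / (2 * P)"] True show False
        by (simp add: field_simps)
    qed
    then show ?thesis by simp
  next
    case False
    then have pos: "0 < (L2norm D v)\<^sup>2" by simp
    let ?t = "P / (L2norm D v)\<^sup>2"
    have "?t * P = P\<^sup>2 / (L2norm D v)\<^sup>2" "?t\<^sup>2 * (L2norm D v)\<^sup>2 = P\<^sup>2 / (L2norm D v)\<^sup>2"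
      using False by (simp_all add: power2_eq_square)
    with quad[of "?t"] have "P\<^sup>2 / (L2norm D v)\<^sup>2 \<le> (L2norm D u)\<^sup>2"
      by linarith
    then show ?thesis
      using pos by (simp add: power_mult_distrib pos_divide_le_eq)
  qed
  then show ?thesis
    unfolding P_def by (rule power2_le_imp_le) (simp add: L2norm_nonneg)
qed

lemma abs_integral_inner_le:
  assumes "u \<in> L2 D" "v \<in> L2 D"
  shows "\<bar>\<integral>x. Re (u x * cnj (v x)) \<partial>lebesgue_on D\<bar> \<le> L2norm D u * L2norm D v"
proof -
  have "\<bar>\<integral>x. Re (u x * cnj (v x)) \<partial>lebesgue_on D\<bar> \<le> (\<integral>x. \<bar>Re (u x * cnj (v x))\<bar> \<partial>lebesgue_on D)"
    using integral_norm_bound[of "lebesgue_on D" "\<lambda>x. Re (u x * cnj (v x))"] by simp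
  also have "\<dots> \<le> (\<integral>x. cmod (u x) * cmod (v x) \<partial>lebesgue_on D)"
  proof (rule integral_mono)
    show "integrable (lebesgue_on D) (\<lambda>x. cmod (u x) * cmod (v x))"
      using integrable_norm[OF L2_mult_integrable[OF assms]] by (simp add: norm_mult)
    show "\<bar>Re (u x * cnj (v x))\<bar> \<le> cmod (u x) * cmod (v x)" for x
      using abs_Re_le_cmod[of "u x * cnj (v x)"] by (simp only: norm_mult complex_mod_cnj)
  qed (use L2_inner_integrable[OF assms] in auto)
  also have "\<dots> \<le> L2norm D u * L2norm D v"
    by (rule L2_Cauchy_Schwarz[OF assms])
  finally show ?thesis .
qed

lemma L2norm_add_power2:
  assumes u: "u \<in> L2 D" and v: "v \<in> L2 D"
  shows "(L2norm D (\<lambda>x. u x + v x))\<^sup>2 =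
    (L2norm D u)\<^sup>2 + 2 * (\<integral>x. Re (u x * cnj (v x)) \<partial>lebesgue_on D) + (L2norm D v)\<^sup>2"
proof -
  have "(cmod (p + q))\<^sup>2 = (cmod p)\<^sup>2 + 2 * Re (p * cnj q) + (cmod q)\<^sup>2" for p q
    by (simp only: cmod_power2) (simp add: power2_eq_square algebra_simps)
  then show ?thesis
    unfolding L2norm_power2
    using u v by (simp add: L2_integrable_power2 L2_inner_integrable del: times_complex.sel)
qed

lemma L2norm_cmult: "L2norm D (\<lambda>x. c * u x) = cmod c * L2norm D u"
  by (simp add: L2norm_def norm_mult power_mult_distrib real_sqrt_mult)

text \<open>
  Write \<open>S h u = u + h (v + r h)\<close> with \<open>r h \<rightarrow> 0\<close> in \<open>L\<^sup>2\<close> and expand the square: the difference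
  quotient is \<open>2 Re \<langle>u, v + r h\<rangle> + h \<parallel>v + r h\<parallel>\<^sup>2\<close>.
\<close>

lemma L2norm_sq_derivative:
  assumes gen: "generator D S u v" and u: "u \<in> L2 D" and v: "v \<in> L2 D"
    and S: "\<And>t. t \<ge> 0 \<Longrightarrow> S t u \<in> L2 D"
  shows "((\<lambda>h. ((L2norm D (S h u))\<^sup>2 - (L2norm D u)\<^sup>2) / h) \<longlongrightarrow>
    2 * (\<integral>x. Re (u x * cnj (v x)) \<partial>lebesgue_on D)) (at_right 0)"
proof -
  define r where "r h x = (S h u x - u x) / of_real h - v x" for h x
  define I where "I = (\<integral>x. Re (u x * cnj (v x)) \<partial>lebesgue_on D)"
  define J where "J h = (\<integral>x. Re (u x * cnj (r h x)) \<partial>lebesgue_on D)" for h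
  have r0: "((\<lambda>h. L2norm D (r h)) \<longlongrightarrow> 0) (at_right 0)"
    using gen by (simp add: generator_def r_def[abs_def])
  have r: "r h \<in> L2 D" if "h > 0" for h
    using L2_diff[OF L2_cmult[OF L2_diff[OF S[of h] u], of "1 / of_real h"] v] that
    by (simp add: r_def[abs_def])
  have J: "(J \<longlongrightarrow> 0) (at_right 0)"
  proof (rule Lim_null_comparison)
    show "\<forall>\<^sub>F h in at_right 0. norm (J h) \<le> L2norm D u * L2norm D (r h)"
      unfolding eventually_at_right_field J_def
      using abs_integral_inner_le[OF u r] by (auto intro!: exI[of _ 1])
    show "((\<lambda>h. L2norm D u * L2norm D (r h)) \<longlongrightarrow> 0) (at_right 0)"
      using tendsto_mult_right_zero[OF r0] .
  qed
  have K: "((\<lambda>h. h * (L2norm D (\<lambda>x. v x + r h x))\<^sup>2) \<longlongrightarrow> 0) (at_right 0)"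
  proof (rule Lim_null_comparison)
    show "\<forall>\<^sub>F h in at_right 0. norm (h * (L2norm D (\<lambda>x. v x + r h x))\<^sup>2)
        \<le> h * ((L2norm D v)\<^sup>2 + 2 * (L2norm D v * L2norm D (r h)) + (L2norm D (r h))\<^sup>2)"
      unfolding eventually_at_right_field
    proof (intro exI[of _ 1] conjI impI allI)
      fix h :: real assume h: "0 < h" "h < 1"
      have "(L2norm D (\<lambda>x. v x + r h x))\<^sup>2 \<le>
          (L2norm D v)\<^sup>2 + 2 * (L2norm D v * L2norm D (r h)) + (L2norm D (r h))\<^sup>2"
        using L2norm_add_power2[OF v r[OF h(1)]] abs_integral_inner_le[OF v r[OF h(1)]] by linarith
      then show "norm (h * (L2norm D (\<lambda>x. v x + r h x))\<^sup>2)
        \<le> h * ((L2norm D v)\<^sup>2 + 2 * (L2norm D v * L2norm D (r h)) + (L2norm D (r h))\<^sup>2)"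
        using h by (simp add: abs_mult mult_left_mono)
    qed simp
    have "((\<lambda>h. h * ((L2norm D v)\<^sup>2 + 2 * (L2norm D v * L2norm D (r h)) + (L2norm D (r h))\<^sup>2)) \<longlongrightarrow>
        0 * ((L2norm D v)\<^sup>2 + 2 * (L2norm D v * 0) + 0\<^sup>2)) (at_right 0)"
      by (intro tendsto_intros r0)
    then show "((\<lambda>h. h * ((L2norm D v)\<^sup>2 + 2 * (L2norm D v * L2norm D (r h)) + (L2norm D (r h))\<^sup>2)) \<longlongrightarrow> 0)
        (at_right 0)"
      by simp
  qed
  have "((\<lambda>h. 2 * (I + J h) + h * (L2norm D (\<lambda>x. v x + r h x))\<^sup>2) \<longlongrightarrow> 2 * (I + 0) + 0) (at_right 0)"
    by (intro tendsto_intros J K)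
  moreover have "\<forall>\<^sub>F h in at_right 0. 2 * (I + J h) + h * (L2norm D (\<lambda>x. v x + r h x))\<^sup>2
      = ((L2norm D (S h u))\<^sup>2 - (L2norm D u)\<^sup>2) / h"
    unfolding eventually_at_right_field
  proof (intro exI[of _ 1] conjI impI allI)
    fix h :: real assume h: "0 < h" "h < 1"
    let ?w = "\<lambda>x. v x + r h x"
    have w: "?w \<in> L2 D"
      using v r[OF h(1)] by (rule L2_add)
    have "S h u = (\<lambda>x. u x + of_real h * ?w x)"
      using h by (auto simp: r_def)
    then have "(L2norm D (S h u))\<^sup>2 = (L2norm D u)\<^sup>2
        + 2 * (\<integral>x. Re (u x * cnj (of_real h * ?w x)) \<partial>lebesgue_on D) + (L2norm D (\<lambda>x. of_real h * ?w x))\<^sup>2"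
      using L2norm_add_power2[OF u L2_cmult[OF w]] by simp
    also have "(\<integral>x. Re (u x * cnj (of_real h * ?w x)) \<partial>lebesgue_on D) =
       (\<integral>x. h * (Re (u x * cnj (v x)) + Re (u x * cnj (r h x))) \<partial>lebesgue_on D)"
      by (intro Bochner_Integration.integral_cong) (auto simp: algebra_simps)
    also have "\<dots> = h * (I + J h)"
      using L2_inner_integrable[OF u v] L2_inner_integrable[OF u r[OF h(1)]]
      unfolding I_def J_def by (simp del: times_complex.sel)
    also have "L2norm D (\<lambda>x. of_real h * ?w x) = h * L2norm D ?w"
      using h by (simp only: L2norm_cmult) simp
    finally show "2 * (I + J h) + h * (L2norm D ?w)\<^sup>2 = ((L2norm D (S h u))\<^sup>2 - (L2norm D u)\<^sup>2) / h"
      using h by (simp add: field_simps power2_eq_square)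
  qed simp
  ultimately show ?thesis
    unfolding I_def[symmetric] by (auto intro: Lim_transform_eventually)
qed

text \<open>
  The heart of the Riesz--Fischer theorem.  On a set of finite measure the increments have summable
  \<open>L\<^sup>1\<close> norms, so they are absolutely summable almost everywhere.  The sum of their absolute
  values gives an integrable majorant of all \<open>u j\<close>, so that integrals
  of \<open>u j\<close> against bounded functions pass to the limit.
\<close>

lemma L2_fast_Cauchy_AE_convergent:
  assumes D: "D \<in> lmeasurable" and u: "\<And>j. u j \<in> L2 D"
    and fast: "\<And>j. L2norm D (\<lambda>x. u (Suc j) x - u j x) \<le> (1 / 2) ^ j"
  obtains h w where "h \<in> borel_measurable (lebesgue_on D)" "integrable (lebesgue_on D) w"
    "\<And>j. AE x in lebesgue_on D. cmod (u j x) \<le> w x"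
    "AE x in lebesgue_on D. (\<lambda>j. u j x) \<longlonglongrightarrow> h x"
proof -
  let ?M = "lebesgue_on D"
  note [measurable] = u[THEN L2_measurable]
  define d where "d j x = cmod (u (Suc j) x - u j x)" for j x
  have dL2: "(\<lambda>x. u (Suc j) x - u j x) \<in> L2 D" for j
    by (intro L2_diff u)
  have one: "(\<lambda>_. 1) \<in> L2 D"
    by (rule L2_bounded[OF D, of _ 1]) auto
  have dint: "integrable ?M (d j)" for j
    unfolding d_def[abs_def] by (intro integrable_norm L2_integrable[OF D] dL2)
  have dle: "(\<integral>x. d j x \<partial>?M) \<le> L2norm D (\<lambda>_. 1) * (1 / 2) ^ j" for j
  proof -
    have "(\<integral>x. d j x \<partial>?M) \<le> L2norm D (\<lambda>_. 1) * L2norm D (\<lambda>x. u (Suc j) x - u j x)"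
      using L2_Cauchy_Schwarz[OF one dL2] by (simp add: d_def[abs_def])
    also have "\<dots> \<le> L2norm D (\<lambda>_. 1) * (1 / 2) ^ j"
      by (intro mult_left_mono fast L2norm_nonneg)
    finally show ?thesis .
  qed
  have d0: "0 \<le> d j x" for j x
    by (simp add: d_def)
  have sumint: "summable (\<lambda>j. \<integral>x. d j x \<partial>?M)"
  proof (rule summable_comparison_test')
    show "summable (\<lambda>j. L2norm D (\<lambda>_. 1) * (1 / 2) ^ j)"
      by (intro summable_mult summable_geometric) simp
    show "norm (\<integral>x. d j x \<partial>?M) \<le> L2norm D (\<lambda>_. 1) * (1 / 2) ^ j" for j
      using dle[of j] by (simp add: integral_nonneg_AE d0)
  qed
  have ae: "AE x in ?M. summable (\<lambda>j. d j x)"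
  proof -
    have "(\<integral>\<^sup>+x. (\<Sum>j. ennreal (d j x)) \<partial>?M) = (\<Sum>j. \<integral>\<^sup>+x. ennreal (d j x) \<partial>?M)"
      by (rule nn_integral_suminf) (use dint in auto)
    also have "\<dots> = (\<Sum>j. ennreal (\<integral>x. d j x \<partial>?M))"
      by (simp add: nn_integral_eq_integral[OF dint] d0)
    also have "\<dots> \<noteq> \<infinity>"
      by (subst suminf_ennreal2) (simp_all add: integral_nonneg_AE d0 sumint)
    finally have "AE x in ?M. (\<Sum>j. ennreal (d j x)) \<noteq> \<infinity>"
      by (intro nn_integral_PInf_AE) (use dint in auto)
    then show ?thesis
      by eventually_elim (auto intro!: summable_suminf_not_top d0)
  qed
  define w where "w x = cmod (u 0 x) + (\<Sum>j. d j x)" for x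
  have tele: "u j x = u 0 x + (\<Sum>i<j. u (Suc i) x - u i x)" for j x
    by (simp add: sum_lessThan_telescope[of "\<lambda>i. u i x"])
  show ?thesis
  proof (rule that[of "\<lambda>x. lim (\<lambda>j. u j x)" w])
    show "(\<lambda>x. lim (\<lambda>j. u j x)) \<in> borel_measurable ?M"
      by measurable
    have "integrable ?M (\<lambda>x. \<Sum>j. d j x)"
      by (rule integrable_suminf) (use dint ae sumint d0 in auto)
    then show "integrable ?M w"
      unfolding w_def[abs_def]
      by (intro Bochner_Integration.integrable_add integrable_norm L2_integrable[OF D] u)
    show "AE x in ?M. cmod (u j x) \<le> w x" for j
      using ae
    proof eventually_elim
      case (elim x)
      have "cmod (u j x) \<le> cmod (u 0 x) + (\<Sum>i<j. d i x)"
        by (subst tele) (auto simp: d_def intro!: order_trans[OF norm_triangle_ineq] norm_sum)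
      also have "(\<Sum>i<j. d i x) \<le> (\<Sum>j. d j x)"
        using elim by (intro sum_le_suminf) (auto simp: d0)
      finally show ?case by (simp add: w_def)
    qed
    show "AE x in ?M. (\<lambda>j. u j x) \<longlonglongrightarrow> lim (\<lambda>j. u j x)"
      using ae
    proof eventually_elim
      case (elim x)
      then have "summable (\<lambda>i. u (Suc i) x - u i x)"
        unfolding d_def by (rule summable_norm_cancel)
      then have "(\<lambda>j. u 0 x + (\<Sum>i<j. u (Suc i) x - u i x)) \<longlonglongrightarrow> u 0 x + (\<Sum>i. u (Suc i) x - u i x)"
        by (intro tendsto_add tendsto_const summable_LIMSEQ)
      then have "convergent (\<lambda>j. u j x)"
        unfolding tele[symmetric] by (auto simp: convergent_def)
      then show ?case by (simp add: convergent_LIMSEQ_iff)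
    qed
  qed
qed

section \<open>Plane waves with the period of the box\<close>

definition wave :: "'a::euclidean_space \<Rightarrow> 'a \<Rightarrow> complex" where
  "wave w x = cis (w \<bullet> x)"

text \<open>
  The point of the dual lattice of the periods of the box with integer coordinates \<open>k\<close>; only the
  values of \<open>k\<close> on \<open>Basis\<close> matter.
\<close>

definition freq :: "'a::euclidean_space \<Rightarrow> 'a \<Rightarrow> ('a \<Rightarrow> int) \<Rightarrow> 'a" where
  "freq a b k = (\<Sum>j\<in>Basis. (2 * pi * of_int (k j) / ((b - a) \<bullet> j)) *\<^sub>R j)"

lemma freq_inner: "i \<in> Basis \<Longrightarrow> freq a b k \<bullet> i = 2 * pi * of_int (k i) / ((b - a) \<bullet> i)"
  by (simp add: freq_def)

lemma freq_add: "freq a b k + freq a b l = freq a b (\<lambda>i. k i + l i)"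
  by (rule euclidean_eqI) (simp only: inner_add_left freq_inner of_int_add distrib_left add_divide_distrib)

lemma freq_uminus: "- freq a b k = freq a b (\<lambda>i. - k i)"
  by (rule euclidean_eqI) (simp only: inner_minus_left freq_inner of_int_minus mult_minus_right minus_divide_left)

lemma freq_0: "freq a b (\<lambda>i. 0) = 0"
  by (simp add: freq_def)

lemma wave_0 [simp]: "wave 0 x = 1"
  by (simp add: wave_def)

lemma wave_mult: "wave v x * wave w x = wave (v + w) x"
  by (simp add: wave_def cis_mult inner_add_left)

lemma cnj_wave: "cnj (wave w x) = wave (- w) x"
  by (simp add: wave_def cis_cnj)

lemma norm_wave [simp]: "cmod (wave w x) = 1"
  by (simp add: wave_def)

lemma wave_has_derivative:
  "(wave w has_derivative (\<lambda>h. \<i> * of_real (w \<bullet> h) * wave w x)) (at x)"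
  unfolding wave_def[abs_def]
  by (auto intro!: derivative_eq_intros simp: scaleR_conv_of_real)

lemma continuous_on_wave [continuous_intros]: "continuous_on A (wave w)"
  by (rule has_derivative_continuous_on) (rule has_derivative_at_withinI[OF wave_has_derivative])

lemma measurable_wave [measurable]: "wave w \<in> borel_measurable borel"
  by (intro borel_measurable_continuous_onI continuous_on_wave)

lemma partial_deriv_cmult_wave:
  "partial_deriv i (\<lambda>x. c * wave w x) = (\<lambda>x. (\<i> * of_real (w \<bullet> i) * c) * wave w x)"
proof
  fix x
  have "((\<lambda>x. c * wave w x) has_derivative (\<lambda>h. c * (\<i> * of_real (w \<bullet> h) * wave w x))) (at x)"
    by (intro has_derivative_mult_right wave_has_derivative)
  then have "frechet_derivative (\<lambda>x. c * wave w x) (at x) = (\<lambda>h. c * (\<i> * of_real (w \<bullet> h) * wave w x))"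
    by (rule frechet_derivative_at[symmetric])
  then show "partial_deriv i (\<lambda>x. c * wave w x) x = (\<i> * of_real (w \<bullet> i) * c) * wave w x"
    by (simp add: partial_deriv_def)
qed

lemma smooth_wave: "smooth (wave w)"
proof -
  have "Ck k (\<lambda>x. c * wave w x)" for k c
  proof (induction k arbitrary: c)
    case 0
    show ?case by (auto intro!: continuous_intros)
  next
    case (Suc k)
    have "(\<lambda>x. c * wave w x) differentiable (at x)" for x
      by (rule differentiableI[OF has_derivative_mult_right[OF wave_has_derivative]])
    then show ?case
      using Suc by (simp add: partial_deriv_cmult_wave)
  qed
  from this[of _ 1] show ?thesis
    by (simp add: smooth_def)
qed

lemma partial_deriv_wave: "partial_deriv i (wave w) = (\<lambda>x. \<i> * of_real (w \<bullet> i) * wave w x)"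
  using partial_deriv_cmult_wave[of i 1 w] by simp

lemma box_periodic_wave:
  assumes "\<And>i. i \<in> Basis \<Longrightarrow> a \<bullet> i < b \<bullet> i"
  shows "box_periodic a b (wave (freq a b k))"
  unfolding box_periodic_def
proof (intro allI ballI)
  fix x i :: 'a assume i: "i \<in> Basis"
  have "(b - a) \<bullet> i \<noteq> 0"
    using assms[OF i] by (simp add: inner_diff_left)
  then have "wave (freq a b k) (x + ((b - a) \<bullet> i) *\<^sub>R i) = wave (freq a b k) x * cis (2 * pi * of_int (k i))"
    unfolding wave_def inner_add_right inner_scaleR_right freq_inner[OF i] cis_mult by simp
  then show "wave (freq a b k) (x + ((b - a) \<bullet> i) *\<^sub>R i) = wave (freq a b k) x"
    by (simp add: cis_multiple_2pi)
qed

lemma integral_lborel_prod_complex: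
  fixes f :: "'a::euclidean_space \<Rightarrow> real \<Rightarrow> complex"
  assumes int: "\<And>i. i \<in> Basis \<Longrightarrow> integrable lborel (f i)"
  shows "(\<integral>x. (\<Prod>i\<in>Basis. f i (x \<bullet> i)) \<partial>lborel) = (\<Prod>i\<in>Basis. \<integral>t. f i t \<partial>lborel)"
proof -
  interpret product_sigma_finite "\<lambda>_::'a. lborel :: real measure"
    by unfold_locales
  have [measurable]: "f i \<in> borel_measurable borel" if "i \<in> Basis" for i
    using borel_measurable_integrable[OF int[OF that]] by simp
  have "(\<integral>x. (\<Prod>i\<in>Basis. f i (x \<bullet> i)) \<partial>lborel) =
     (\<integral>y. (\<Prod>i\<in>Basis. f i ((\<Sum>b\<in>Basis. y b *\<^sub>R b) \<bullet> i)) \<partial>(\<Pi>\<^sub>M b\<in>(Basis::'a set). (lborel::real measure)))"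
    by (subst lborel_eq, subst integral_distr) auto
  also have "\<dots> = (\<integral>y. (\<Prod>i\<in>Basis. f i (y i)) \<partial>(\<Pi>\<^sub>M b\<in>(Basis::'a set). (lborel::real measure)))"
    by (intro Bochner_Integration.integral_cong prod.cong refl)
       simp
  also have "\<dots> = (\<Prod>i\<in>Basis. \<integral>t. f i t \<partial>lborel)"
    by (rule product_integral_prod) (auto intro: int)
  finally show ?thesis .
qed

lemma integral_cis_period:
  fixes c d :: real and n :: int
  assumes "c < d" "n \<noteq> 0"
  shows "(\<integral>t. indicator {c..d} t *\<^sub>R cis (2 * pi * n / (d - c) * t) \<partial>lborel) = 0"
proof -
  define w where "w = 2 * pi * n / (d - c)"
  have "w * (d - c) = 2 * pi * n"
    using assms by (simp add: w_def)
  then have w: "w \<noteq> 0" "w * d = w * c + 2 * pi * n"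
    using assms by (auto simp: right_diff_distrib)
  define F where "F t = cis (w * t) / (\<i> * of_real w)" for t
  have "(F has_vector_derivative cis (w * t)) (at t within {c..d})" for t
    unfolding F_def has_vector_derivative_def
    using w(1) by (auto intro!: derivative_eq_intros simp: scaleR_conv_of_real mult.left_commute[of \<i> "of_real _"])
  then have "(\<integral>t. indicator {c..d} t *\<^sub>R cis (w * t) \<partial>lborel) = F d - F c"
    using assms
    by (intro integral_FTC_Icc) (auto intro!: continuous_intros)
  also have "cis (w * d) = cis (w * c)"
    unfolding w(2) cis_mult[symmetric] by (simp add: cis_multiple_2pi)
  then have "F d - F c = 0"
    by (simp add: F_def)
  finally show ?thesis by (simp add: w_def)
qed

lemma cis_sum: "cis (\<Sum>i\<in>A. g i) = (\<Prod>i\<in>A. cis (g i))"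
  by (induction A rule: infinite_finite_induct) (simp_all flip: cis_mult)

lemma cbox_minus_box_null:
  assumes "\<And>i. i \<in> Basis \<Longrightarrow> a \<bullet> i < b \<bullet> i"
  shows "cbox a b - box a b \<in> null_sets lborel"
proof (rule null_setsI)
  have "\<forall>i\<in>Basis. a \<bullet> i \<le> b \<bullet> i"
    using assms by (auto intro: less_imp_le)
  then have "emeasure lborel (cbox a b) = emeasure lborel (box a b)"
    by (simp only: emeasure_lborel_cbox_eq emeasure_lborel_box_eq)
  then show "emeasure lborel (cbox a b - box a b) = 0"
    by (subst emeasure_Diff) (use box_subset_cbox[of a b] emeasure_lborel_box_finite[of a b] in auto)
qed auto

lemma indicator_cbox_prod:
  fixes x :: "'a::euclidean_space"
  shows "(indicator (cbox a b) x :: real) = (\<Prod>i\<in>Basis. indicator {a \<bullet> i..b \<bullet> i} (x \<bullet> i))"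
proof (cases "x \<in> cbox a b")
  case False
  then obtain i where "i \<in> Basis" "x \<bullet> i \<notin> {a \<bullet> i..b \<bullet> i}"
    by (auto simp: mem_box)
  then have "(\<Prod>i\<in>Basis. indicator {a \<bullet> i..b \<bullet> i} (x \<bullet> i)) = (0::real)"
    by (intro prod_zero bexI[of _ i]) auto
  with False show ?thesis by simp
qed (simp add: mem_box)

text \<open>
  By Fubini the integral is a product of one-dimensional integrals, and a coordinate with
  \<open>k i \<noteq> 0\<close> contributes the integral of an oscillation over full periods.
\<close>

lemma integral_wave:
  fixes a b :: "'a::euclidean_space"
  assumes ab: "\<And>i. i \<in> Basis \<Longrightarrow> a \<bullet> i < b \<bullet> i" and k: "\<exists>i\<in>Basis. k i \<noteq> 0"
  shows "(\<integral>x. wave (freq a b k) x \<partial>lebesgue_on (box a b)) = 0"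
proof -
  let ?f = "\<lambda>i t. indicator {a \<bullet> i..b \<bullet> i} t *\<^sub>R cis (2 * pi * of_int (k i) / (b \<bullet> i - a \<bullet> i) * t)"
  have "(\<integral>x. wave (freq a b k) x \<partial>lebesgue_on (box a b)) =
      (\<integral>x. indicator (box a b) x *\<^sub>R wave (freq a b k) x \<partial>lebesgue)"
    by (simp add: integral_restrict_space set_lebesgue_integral_def)
  also have "\<dots> = (\<integral>x. indicator (box a b) x *\<^sub>R wave (freq a b k) x \<partial>lborel)"
    by (rule integral_completion) measurable
  also have "\<dots> = (\<integral>x. indicator (cbox a b) x *\<^sub>R wave (freq a b k) x \<partial>lborel)"
  proof (rule integral_cong_AE)
    show "AE x in lborel. indicator (box a b) x *\<^sub>R wave (freq a b k) x = indicator (cbox a b) x *\<^sub>R wave (freq a b k) x"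
      by (rule AE_I'[OF cbox_minus_box_null[OF ab]])
         (use box_subset_cbox[of a b] in \<open>auto simp: indicator_def split: if_splits\<close>)
  qed measurable
  also have "\<dots> = (\<integral>x. (\<Prod>i\<in>Basis. ?f i (x \<bullet> i)) \<partial>lborel)"
  proof (intro Bochner_Integration.integral_cong refl)
    fix x :: 'a
    have "freq a b k \<bullet> x = (\<Sum>i\<in>Basis. 2 * pi * of_int (k i) / (b \<bullet> i - a \<bullet> i) * (x \<bullet> i))"
      unfolding freq_def inner_sum_left inner_diff_left inner_scaleR_left by (simp add: inner_commute)
    then have "wave (freq a b k) x = (\<Prod>i\<in>Basis. cis (2 * pi * of_int (k i) / (b \<bullet> i - a \<bullet> i) * (x \<bullet> i)))"
      by (simp only: wave_def cis_sum)
    then show "indicator (cbox a b) x *\<^sub>R wave (freq a b k) x = (\<Prod>i\<in>Basis. ?f i (x \<bullet> i))"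
      by (simp only: scaleR_conv_of_real prod.distrib indicator_cbox_prod of_real_prod)
  qed
  also have "\<dots> = (\<Prod>i\<in>Basis. \<integral>t. ?f i t \<partial>lborel)"
    by (intro integral_lborel_prod_complex borel_integrable_compact)
       (auto intro!: continuous_intros simp: less_imp_neq[OF ab])
  also have "\<dots> = 0"
  proof -
    from k obtain i where i: "i \<in> Basis" "k i \<noteq> 0" by blast
    have "(\<integral>t. ?f i t \<partial>lborel) = 0"
      by (rule integral_cis_period) (use ab i in auto)
    with i show ?thesis
      by (intro prod_zero bexI[of _ i]) auto
  qed
  finally show ?thesis .
qed

section \<open>Completeness of the trigonometric system\<close>

text \<open>
  The linear span of the plane waves.  Generating it by addition alone makes a linear functional
  that kills every plane wave kill all of it by a direct induction; closure under products is a
  consequence.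
\<close>

inductive trig_poly :: "'a::euclidean_space \<Rightarrow> 'a \<Rightarrow> ('a \<Rightarrow> complex) \<Rightarrow> bool" for a b where
  monomial: "trig_poly a b (\<lambda>x. c * wave (freq a b k) x)"
| add: "trig_poly a b p \<Longrightarrow> trig_poly a b q \<Longrightarrow> trig_poly a b (\<lambda>x. p x + q x)"

lemma trig_poly_const: "trig_poly a b (\<lambda>x. c)"
  using trig_poly.monomial[of a b c "\<lambda>_. 0"] by (simp add: freq_0)

lemma trig_poly_mult:
  assumes "trig_poly a b p" "trig_poly a b q"
  shows "trig_poly a b (\<lambda>x. p x * q x)"
  using assms(1)
proof induction
  case (monomial c k)
  from assms(2) show ?case
  proof induction
    case (monomial d l)
    have "(c * wave (freq a b k) x) * (d * wave (freq a b l) x)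
        = (c * d) * wave (freq a b (\<lambda>i. k i + l i)) x" for x
      by (simp add: wave_mult[symmetric] freq_add[symmetric])
    then show ?case
      by (simp only: trig_poly.monomial)
  next
    case (add p q)
    then show ?case by (simp only: distrib_left trig_poly.add)
  qed
next
  case (add p q)
  then show ?case by (simp only: distrib_right trig_poly.add)
qed

lemma trig_poly_prod:
  "(\<And>i. i \<in> I \<Longrightarrow> trig_poly a b (p i)) \<Longrightarrow> trig_poly a b (\<lambda>x. \<Prod>i\<in>I. p i x)"
  by (induction I rule: infinite_finite_induct) (auto intro: trig_poly_mult trig_poly_const)

lemma trig_poly_cos:
  assumes i: "i \<in> Basis"
  shows "trig_poly a b (\<lambda>x. of_real (cos (2 * pi * (x \<bullet> i - m) / ((b - a) \<bullet> i))))"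
proof -
  define L where "L = (b - a) \<bullet> i"
  define k where "k = (\<lambda>j. if j = i then 1 else 0 :: int)"
  define e where "e = cis (2 * pi * m / L)"
  have k: "freq a b k \<bullet> x = 2 * pi * (x \<bullet> i) / L" for x
  proof -
    have "freq a b k = (2 * pi / L) *\<^sub>R i"
    proof (rule euclidean_eqI)
      fix j :: 'a assume "j \<in> Basis"
      with i show "freq a b k \<bullet> j = ((2 * pi / L) *\<^sub>R i) \<bullet> j"
        by (cases "j = i") (auto simp: freq_inner k_def L_def inner_Basis)
    qed
    then show ?thesis by (simp add: inner_commute)
  qed
  have "of_real (cos (2 * pi * (x \<bullet> i - m) / L)) =
      (cnj e / 2) * wave (freq a b k) x + (e / 2) * wave (freq a b (\<lambda>j. - k j)) x" for x
  proof -
    have "2 * pi * (x \<bullet> i - m) / L = freq a b k \<bullet> x + - (2 * pi * m / L)"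
      unfolding k by (simp add: diff_divide_distrib right_diff_distrib)
    then have *: "cis (2 * pi * (x \<bullet> i - m) / L) = wave (freq a b k) x * cnj e"
      unfolding e_def wave_def cis_cnj by (simp only: cis_mult)
    have "2 * of_real (cos t) = cis t + cnj (cis t)" for t
      by (simp add: complex_eq_iff)
    from this[of "2 * pi * (x \<bullet> i - m) / L"] show ?thesis
      unfolding * by (simp add: cnj_wave freq_uminus field_simps)
  qed
  then show ?thesis
    unfolding L_def[symmetric] by (simp only: trig_poly.intros)
qed

lemma trig_poly_real_polynomial:
  assumes "real_polynomial_function p" and f: "trig_poly a b (\<lambda>x. of_real (f x))"
  shows "trig_poly a b (\<lambda>x. of_real (p (f x)))"
  using assms(1)
proof induction
  case (linear g)
  have "g s = g 1 * s" for s :: real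
    using linear_scale[OF bounded_linear.linear[OF linear], of s 1] by (simp add: mult.commute)
  then have "(\<lambda>x. complex_of_real (g (f x))) = (\<lambda>x. of_real (g 1) * of_real (f x))"
    by (metis of_real_mult)
  then show ?case
    using trig_poly_mult[OF trig_poly_const f] by simp
next
  case (const c)
  show ?case by (rule trig_poly_const)
next
  case (add p q)
  then show ?case by (simp only: of_real_add trig_poly.add)
next
  case (mult p q)
  then show ?case by (simp only: of_real_mult trig_poly_mult)
qed

text \<open>
  A superlevel set of a cosine of period \<open>L\<close> is, within the stated range of \<open>t\<close>, a single interval.
  For \<open>|t| > L / 2\<close> the argument is reflected to \<open>L - |t|\<close>, which is larger than \<open>h\<close>, so the range
  stops before the next arch is reached.
\<close>

lemma cos_less_cos_iff_abs:
  fixes L h t :: real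
  assumes h: "0 < h" "h \<le> L / 2" and t: "\<bar>t\<bar> < L - h"
  shows "cos (2 * pi * h / L) < cos (2 * pi * t / L) \<longleftrightarrow> \<bar>t\<bar> < h"
proof -
  have L: "0 < L" using h by simp
  have mono: "cos (2 * pi * h / L) < cos (2 * pi * s / L) \<longleftrightarrow> s < h" if "0 \<le> s" "s \<le> L / 2" for s
  proof -
    have "2 * pi * h / L \<le> pi" "2 * pi * s / L \<le> pi"
      using h that L by (simp_all add: field_simps)
    then have "cos (2 * pi * h / L) < cos (2 * pi * s / L) \<longleftrightarrow> 2 * pi * s / L < 2 * pi * h / L"
      using h that L by (intro cos_mono_less_eq) auto
    also have "\<dots> \<longleftrightarrow> s < h"
      using L by (simp add: divide_less_cancel)
    finally show ?thesis .
  qed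
  have "cos (2 * pi * t / L) = cos (2 * pi * \<bar>t\<bar> / L)"
    by (cases "t \<ge> 0") auto
  moreover have "cos (2 * pi * h / L) < cos (2 * pi * \<bar>t\<bar> / L) \<longleftrightarrow> \<bar>t\<bar> < h"
  proof (cases "\<bar>t\<bar> \<le> L / 2")
    case True
    then show ?thesis by (intro mono) auto
  next
    case False
    have "2 * pi * \<bar>t\<bar> / L = 2 * pi - 2 * pi * (L - \<bar>t\<bar>) / L"
      using L by (simp add: field_simps)
    then have "cos (2 * pi * \<bar>t\<bar> / L) = cos (2 * pi * (L - \<bar>t\<bar>) / L)"
      by (simp only: cos_2pi_minus)
    moreover have "cos (2 * pi * h / L) < cos (2 * pi * (L - \<bar>t\<bar>) / L) \<longleftrightarrow> L - \<bar>t\<bar> < h"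
      using False t h by (intro mono) auto
    ultimately show ?thesis
      using False t h by auto
  qed
  ultimately show ?thesis by simp
qed

text \<open>
  Uniform approximation, by Weierstrass, of the continuous ramps \<open>min 1 (n * max 0 (s - c))\<close>, which
  increase to the indicator of \<open>s > c\<close>.
\<close>

lemma real_polynomials_to_step:
  fixes c :: real
  obtains p :: "nat \<Rightarrow> real \<Rightarrow> real" where
    "\<And>n. real_polynomial_function (p n)"
    "\<And>n s. s \<in> {-1..1} \<Longrightarrow> \<bar>p n s\<bar> \<le> 2"
    "\<And>s. s \<in> {-1..1} \<Longrightarrow> (\<lambda>n. p n s) \<longlonglongrightarrow> (if c < s then 1 else 0)"
proof -
  define f where "f n s = min 1 (real n * max 0 (s - c))" for n s
  have "\<exists>p. real_polynomial_function p \<and> (\<forall>s\<in>{-1..1}. \<bar>f n s - p s\<bar> < inverse (real (Suc n)))" for n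
    by (rule Stone_Weierstrass_real_polynomial_function[of "{-1..1}" "f n" "inverse (real (Suc n))"])
       (auto simp: f_def[abs_def] intro!: continuous_intros)
  then obtain p where p: "\<And>n. real_polynomial_function (p n)"
    "\<And>n s. s \<in> {-1..1} \<Longrightarrow> \<bar>f n s - p n s\<bar> < inverse (real (Suc n))"
    by metis
  show ?thesis
  proof (rule that[OF p(1)])
    fix n and s :: real assume s: "s \<in> {-1..1}"
    have "inverse (real (Suc n)) \<le> 1"
      by (simp add: field_simps)
    moreover have "0 \<le> f n s" "f n s \<le> 1"
      by (auto simp: f_def)
    ultimately show "\<bar>p n s\<bar> \<le> 2"
      using p(2)[OF s, of n] by linarith
  next
    fix s :: real assume s: "s \<in> {-1..1}"
    have "(\<lambda>n. f n s) \<longlonglongrightarrow> (if c < s then 1 else 0)"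
    proof (cases "c < s")
      case True
      obtain N :: nat where N: "1 / (s - c) < real N"
        using reals_Archimedean2 by blast
      have "f n s = 1" if "n \<ge> N" for n
      proof -
        have "1 / (s - c) \<le> real n"
          using N that by linarith
        then have "1 \<le> real n * (s - c)"
          using True by (simp add: divide_le_eq)
        then show ?thesis
          using True by (simp add: f_def)
      qed
      then have "\<forall>\<^sub>F n in sequentially. f n s = 1"
        by (auto simp: eventually_sequentially)
      then show ?thesis
        using True by (simp add: tendsto_eventually)
    qed (simp add: f_def)
    moreover have "(\<lambda>n. f n s - p n s) \<longlonglongrightarrow> 0"
      using p(2)[OF s]
      by (intro Lim_null_comparison[OF always_eventually LIMSEQ_inverse_real_of_nat])
         (simp add: less_imp_le)
    ultimately show "(\<lambda>n. p n s) \<longlonglongrightarrow> (if c < s then 1 else 0)"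
      using tendsto_diff[of "\<lambda>n. f n s" _ sequentially "\<lambda>n. f n s - p n s" 0] by simp
  qed
qed

text \<open>
  The interval is where \<open>cos (2 \<pi> (t - m) / L)\<close>, with \<open>m\<close> its midpoint, exceeds the value at the
  end points, so polynomials in this cosine that approximate a step function do the job.
\<close>

lemma trig_polys_to_interval:
  fixes a b :: "'a::euclidean_space"
  assumes i: "i \<in> Basis" and cd: "a \<bullet> i \<le> c" "c < d" "d \<le> b \<bullet> i"
  obtains P :: "nat \<Rightarrow> 'a \<Rightarrow> complex" where
    "\<And>n. trig_poly a b (P n)" "\<And>n x. cmod (P n x) \<le> 2"
    "\<And>x. x \<in> box a b \<Longrightarrow> (\<lambda>n. P n x) \<longlonglongrightarrow> indicator {c<..<d} (x \<bullet> i)"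
proof -
  define L where "L = (b - a) \<bullet> i"
  define m where "m = (c + d) / 2"
  define h where "h = (d - c) / 2"
  have h: "0 < h" "h \<le> L / 2"
    using cd by (auto simp: h_def L_def inner_diff_left)
  obtain p :: "nat \<Rightarrow> real \<Rightarrow> real" where p: "\<And>n. real_polynomial_function (p n)"
    "\<And>n s. s \<in> {-1..1} \<Longrightarrow> \<bar>p n s\<bar> \<le> 2"
    "\<And>s. s \<in> {-1..1} \<Longrightarrow> (\<lambda>n. p n s) \<longlonglongrightarrow> (if cos (2 * pi * h / L) < s then 1 else 0)"
    using real_polynomials_to_step by blast
  define \<theta> where "\<theta> x = cos (2 * pi * (x \<bullet> i - m) / L)" for x
  have \<theta>: "\<theta> x \<in> {-1..1}" for x
    by (simp add: \<theta>_def)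
  show ?thesis
  proof
    show "trig_poly a b (\<lambda>x. of_real (p n (\<theta> x)))" for n
      unfolding \<theta>_def L_def by (rule trig_poly_real_polynomial[OF p(1) trig_poly_cos[OF i]])
    show "cmod (of_real (p n (\<theta> x))) \<le> 2" for n x
      using p(2)[OF \<theta>] by simp
    fix x assume x: "x \<in> box a b"
    have "\<bar>x \<bullet> i - m\<bar> < L - h"
      using x i cd by (auto simp: m_def L_def h_def mem_box inner_diff_left abs_less_iff field_simps)
    then have "cos (2 * pi * h / L) < \<theta> x \<longleftrightarrow> \<bar>x \<bullet> i - m\<bar> < h"
      unfolding \<theta>_def by (rule cos_less_cos_iff_abs[OF h])
    also have "\<dots> \<longleftrightarrow> x \<bullet> i \<in> {c<..<d}"
      by (auto simp: m_def h_def abs_less_iff field_simps)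
    finally have "(if cos (2 * pi * h / L) < \<theta> x then 1 else 0) = (indicator {c<..<d} (x \<bullet> i) :: real)"
      by simp
    then have "(\<lambda>n. p n (\<theta> x)) \<longlonglongrightarrow> indicator {c<..<d} (x \<bullet> i)"
      using p(3)[OF \<theta>, of x] by simp
    then have "(\<lambda>n. complex_of_real (p n (\<theta> x))) \<longlonglongrightarrow> of_real (indicator {c<..<d} (x \<bullet> i))"
      by (rule tendsto_of_real)
    then show "(\<lambda>n. complex_of_real (p n (\<theta> x))) \<longlonglongrightarrow> indicator {c<..<d} (x \<bullet> i)"
      by (cases "x \<bullet> i \<in> {c<..<d}") (simp_all only: indicator_simps of_real_0 of_real_1 not_False_eq_True)
  qed
qed

lemma trig_polys_to_box:
  fixes a b :: "'a::euclidean_space"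
  assumes cd: "\<And>i. i \<in> Basis \<Longrightarrow> a \<bullet> i \<le> c \<bullet> i \<and> c \<bullet> i < d \<bullet> i \<and> d \<bullet> i \<le> b \<bullet> i"
  obtains P :: "nat \<Rightarrow> 'a \<Rightarrow> complex" where
    "\<And>n. trig_poly a b (P n)" "\<And>n x. cmod (P n x) \<le> 2 ^ DIM('a)"
    "\<And>x. x \<in> box a b \<Longrightarrow> (\<lambda>n. P n x) \<longlonglongrightarrow> indicator (box c d) x"
proof -
  have "\<exists>P. (\<forall>n. trig_poly a b (P n)) \<and> (\<forall>n x. cmod (P n x) \<le> 2) \<and>
      (\<forall>x\<in>box a b. (\<lambda>n. P n x) \<longlonglongrightarrow> indicator {c \<bullet> i<..<d \<bullet> i} (x \<bullet> i))" if "i \<in> Basis" for i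
    using trig_polys_to_interval[OF that, of a "c \<bullet> i" "d \<bullet> i" b] cd[OF that] by metis
  then obtain P where P: "\<And>i n. i \<in> Basis \<Longrightarrow> trig_poly a b (P i n)"
    "\<And>i n x. i \<in> Basis \<Longrightarrow> cmod (P i n x) \<le> 2"
    "\<And>i x. i \<in> Basis \<Longrightarrow> x \<in> box a b \<Longrightarrow>
      (\<lambda>n. P i n x) \<longlonglongrightarrow> indicator {c \<bullet> i<..<d \<bullet> i} (x \<bullet> i)"
    by metis
  show ?thesis
  proof
    show "trig_poly a b (\<lambda>x. \<Prod>i\<in>Basis. P i n x)" for n
      by (intro trig_poly_prod P)
    show "cmod (\<Prod>i\<in>Basis. P i n x) \<le> 2 ^ DIM('a)" for n x
      unfolding prod_norm[symmetric] by (rule order_trans[OF prod_mono[of _ _ "\<lambda>_. 2"]]) (auto intro: P)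
    fix x assume x: "x \<in> box a b"
    have "(\<Prod>i\<in>Basis. indicator {c \<bullet> i<..<d \<bullet> i} (x \<bullet> i)) = (indicator (box c d) x :: complex)"
    proof (cases "x \<in> box c d")
      case False
      then obtain i where "i \<in> Basis" "x \<bullet> i \<notin> {c \<bullet> i<..<d \<bullet> i}"
        by (auto simp: mem_box)
      then have "(\<Prod>i\<in>Basis. indicator {c \<bullet> i<..<d \<bullet> i} (x \<bullet> i)) = (0::complex)"
        by (intro prod_zero bexI[of _ i]) auto
      with False show ?thesis by simp
    qed (simp add: mem_box)
    moreover have "(\<lambda>n. \<Prod>i\<in>Basis. P i n x) \<longlonglongrightarrow> (\<Prod>i\<in>Basis. indicator {c \<bullet> i<..<d \<bullet> i} (x \<bullet> i))"
      by (intro tendsto_prod P x)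
    ultimately show "(\<lambda>n. \<Prod>i\<in>Basis. P i n x) \<longlonglongrightarrow> indicator (box c d) x"
      by simp
  qed
qed

lemma integral_indicator_zero_imp_AE_zero:
  fixes f :: "'b \<Rightarrow> real"
  assumes f: "integrable M f" and zero: "\<And>A. A \<in> sets M \<Longrightarrow> (\<integral>x. indicator A x * f x \<partial>M) = 0"
  shows "AE x in M. f x = 0"
proof -
  have [measurable]: "f \<in> borel_measurable M"
    using f by auto
  have nonpos: "AE x in M. g x \<le> 0"
    if g: "integrable M g" and g0: "\<And>A. A \<in> sets M \<Longrightarrow> (\<integral>x. indicator A x * g x \<partial>M) = 0" for g :: "'b \<Rightarrow> real"
  proof -
    have [measurable]: "g \<in> borel_measurable M"
      using g by auto
    let ?A = "{x \<in> space M. 0 < g x}"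
    have "integrable M (\<lambda>x. indicator ?A x *\<^sub>R g x)"
      by (intro integrable_mult_indicator g) measurable
    moreover have "(\<integral>x. indicator ?A x * g x \<partial>M) = 0"
      by (intro g0) measurable
    moreover have "AE x in M. 0 \<le> indicator ?A x * g x"
      by (auto simp: indicator_def)
    ultimately have "AE x in M. indicator ?A x * g x = 0"
      using integral_nonneg_eq_0_iff_AE[of M "\<lambda>x. indicator ?A x * g x"] by simp
    then show ?thesis
      by (rule AE_mp) (auto simp: indicator_def intro!: AE_I2 split: if_splits)
  qed
  have "AE x in M. f x \<le> 0"
    using f zero by (rule nonpos)
  moreover have "AE x in M. - f x \<le> 0"
    using f zero by (intro nonpos) auto
  ultimately show ?thesis
    by eventually_elim auto
qed

lemma AE_lebesgue_on_borel_set: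
  assumes "A \<in> sets (lebesgue_on D)" "D \<in> sets lebesgue"
  obtains S where "S \<in> sets borel" "AE x in lebesgue_on D. x \<in> A \<longleftrightarrow> x \<in> S"
proof -
  have "A \<in> sets (completion lborel)"
    using assms by (simp add: sets_restrict_space_iff)
  then obtain S N N' where SN: "A = S \<union> N" "N \<subseteq> N'" "N' \<in> null_sets lborel" "S \<in> sets lborel"
    by (rule sets_completionE)
  have "AE x in lebesgue. x \<notin> N'"
    using SN(3) by (intro AE_completion AE_not_in)
  then have "AE x in lebesgue_on D. x \<in> A \<longleftrightarrow> x \<in> S"
    using assms(2) SN(1,2) by (subst AE_restrict_space_iff) auto
  with SN(4) show ?thesis by (intro that) auto
qed

text \<open>
  The function integrates to zero against every trigonometric polynomial, hence against indicators
  of boxes by dominated convergence, hence against indicators of Borel sets by a Dynkin class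
  argument.
\<close>

lemma trig_complete:
  fixes a b :: "'a::euclidean_space" and f :: "'a \<Rightarrow> complex"
  assumes f: "integrable (lebesgue_on (box a b)) f"
    and zero: "\<And>k. (\<integral>x. f x * wave (freq a b k) x \<partial>lebesgue_on (box a b)) = 0"
  shows "AE x in lebesgue_on (box a b). f x = 0"
proof -
  let ?M = "lebesgue_on (box a b)"
  have fm [measurable]: "f \<in> borel_measurable ?M"
    using f by auto
  have borel: "g \<in> borel_measurable ?M" if "g \<in> borel_measurable borel" for g :: "'a \<Rightarrow> complex"
    using that by (intro measurable_restrict_space1 measurable_completion) simp
  have int: "integrable ?M (\<lambda>x. p x * f x)"
    if p: "p \<in> borel_measurable borel" "\<And>x. cmod (p x) \<le> B" for p B
  proof -
    have "integrable ?M (\<lambda>x. B * cmod (f x))"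
      using f by simp
    then show ?thesis
    proof (rule Bochner_Integration.integrable_bound)
      show "AE x in ?M. cmod (p x * f x) \<le> norm (B * cmod (f x))"
        using p(2) by (auto simp: norm_mult abs_mult intro!: AE_I2 mult_right_mono order_trans[OF _ abs_ge_self])
    qed (use borel[OF p(1)] in measurable)
  qed
  have indint: "integrable ?M (\<lambda>x. indicator A x * f x)" if "A \<in> sets borel" for A
    by (rule int[of _ 1]) (use that in simp, simp add: indicator_def)
  have poly: "integrable ?M (\<lambda>x. p x * f x) \<and> (\<integral>x. p x * f x \<partial>?M) = 0" if "trig_poly a b p" for p
    using that
  proof induction
    case (monomial c k)
    have "integrable ?M (\<lambda>x. wave (freq a b k) x * f x)"
      by (rule int[of _ 1]) auto
    then have "integrable ?M (\<lambda>x. c * (wave (freq a b k) x * f x))"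
      by simp
    moreover have "(\<integral>x. c * (wave (freq a b k) x * f x) \<partial>?M) = 0"
      using zero[of k] by (simp add: mult.commute)
    ultimately show ?case
      by (simp add: mult.assoc)
  next
    case (add p q)
    then show ?case by (simp add: distrib_right)
  qed
  have small_box: "(\<integral>x. indicator (box c d) x * f x \<partial>?M) = 0"
    if cd: "\<And>i. i \<in> Basis \<Longrightarrow> a \<bullet> i \<le> c \<bullet> i \<and> c \<bullet> i < d \<bullet> i \<and> d \<bullet> i \<le> b \<bullet> i" for c d
  proof -
    obtain P :: "nat \<Rightarrow> 'a \<Rightarrow> complex" where P: "\<And>n. trig_poly a b (P n)" "\<And>n x. cmod (P n x) \<le> 2 ^ DIM('a)"
      "\<And>x. x \<in> box a b \<Longrightarrow> (\<lambda>n. P n x) \<longlonglongrightarrow> indicator (box c d) x"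
      using trig_polys_to_box[OF cd] by blast
    have "(\<lambda>n. \<integral>x. P n x * f x \<partial>?M) \<longlonglongrightarrow> (\<integral>x. indicator (box c d) x * f x \<partial>?M)"
    proof (rule integral_dominated_convergence[where w = "\<lambda>x. 2 ^ DIM('a) * cmod (f x)"])
      show "(\<lambda>x. indicator (box c d) x * f x) \<in> borel_measurable ?M"
        by (rule borel_measurable_integrable[OF indint]) simp
      show "(\<lambda>x. P n x * f x) \<in> borel_measurable ?M" for n
        by (rule borel_measurable_integrable[OF conjunct1[OF poly[OF P(1)]]])
      show "AE x in ?M. (\<lambda>n. P n x * f x) \<longlonglongrightarrow> indicator (box c d) x * f x"
        by (intro AE_I2 tendsto_intros P) auto
      show "AE x in ?M. cmod (P n x * f x) \<le> 2 ^ DIM('a) * cmod (f x)" for n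
        by (intro AE_I2) (auto simp: norm_mult intro!: mult_right_mono P)
    qed (use f in auto)
    then show ?thesis
      using poly[OF P(1)] by (simp add: LIMSEQ_const_iff)
  qed
  have box: "(\<integral>x. indicator (box c d) x * f x \<partial>?M) = 0" for c d
  proof -
    \<comment> \<open>Corners of the intersection with the domain, which is empty unless \<open>c'\<close> lies below \<open>d'\<close> in every coordinate.\<close>
    define c' where "c' = (\<Sum>i\<in>Basis. max (a \<bullet> i) (c \<bullet> i) *\<^sub>R i)"
    define d' where "d' = (\<Sum>i\<in>Basis. min (b \<bullet> i) (d \<bullet> i) *\<^sub>R i)"
    have eq: "indicator (box c d) x = (indicator (box c' d') x :: complex)" if "x \<in> box a b" for x
      using that by (auto simp: indicator_def mem_box c'_def d'_def)
    have "(\<integral>x. indicator (box c d) x * f x \<partial>?M) = (\<integral>x. indicator (box c' d') x * f x \<partial>?M)"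
      by (intro Bochner_Integration.integral_cong) (auto simp: eq)
    also have "\<dots> = 0"
    proof (cases "box c' d' = {}")
      case False
      then have "\<And>i. i \<in> Basis \<Longrightarrow> c' \<bullet> i < d' \<bullet> i"
        by (auto simp: box_ne_empty)
      then show ?thesis
        by (intro small_box) (auto simp: c'_def d'_def)
    qed simp
    finally show ?thesis .
  qed
  have borel_set: "(\<integral>x. indicator A x * f x \<partial>?M) = 0" if "A \<in> sets borel" for A
  proof -
    let ?G = "range (\<lambda>(c, d). box c d :: 'a set)"
    have sets_eq: "sigma_sets UNIV ?G = sets borel"
      by (subst borel_eq_box) simp
    have "Int_stable ?G"
      by (auto simp: Int_stable_def box_Int_box)
    moreover have "?G \<subseteq> Pow UNIV"
      by auto
    moreover have "A \<in> sigma_sets UNIV ?G"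
      using that by (simp add: sets_eq)
    ultimately show ?thesis
    proof (induction rule: sigma_sets_induct_disjoint)
      case (basic A)
      then show ?case using box by auto
    next
      case empty
      show ?case by simp
    next
      case (compl A)
      have "(\<integral>x. indicator (UNIV - A) x * f x \<partial>?M) = (\<integral>x. f x - indicator A x * f x \<partial>?M)"
        by (intro Bochner_Integration.integral_cong) (auto simp: indicator_def)
      also have "\<dots> = 0"
        using compl f indint[of A] zero[of "\<lambda>_. 0"] by (simp add: sets_eq freq_0)
      finally show ?case .
    next
      case (union A)
      have A: "A i \<in> sets borel" for i
        using union(2) by (auto simp: sets_eq)
      have "(\<integral>x. indicator (\<Union>i<n. A i) x * f x \<partial>?M) = 0" for n
      proof -
        have "(\<integral>x. indicator (\<Union>i<n. A i) x * f x \<partial>?M) = (\<integral>x. (\<Sum>i<n. indicator (A i) x * f x) \<partial>?M)"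
          using disjoint_family_on_mono[OF subset_UNIV union(1)]
          by (intro Bochner_Integration.integral_cong)
             (auto simp: indicator_UN_disjoint sum_distrib_right)
        also have "\<dots> = (\<Sum>i<n. \<integral>x. indicator (A i) x * f x \<partial>?M)"
          by (intro Bochner_Integration.integral_sum indint A)
        also have "\<dots> = 0"
          using union(3) by simp
        finally show ?thesis .
      qed
      moreover have "(\<lambda>n. \<integral>x. indicator (\<Union>i<n. A i) x * f x \<partial>?M) \<longlonglongrightarrow>
          (\<integral>x. indicator (\<Union>i. A i) x * f x \<partial>?M)"
      proof (rule integral_dominated_convergence[where w = "\<lambda>x. cmod (f x)"])
        show "AE x in ?M. (\<lambda>n. indicator (\<Union>i<n. A i) x * f x) \<longlonglongrightarrow> indicator (\<Union>i. A i) x * f x"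
          by (intro AE_I2 tendsto_mult LIMSEQ_indicator_UN tendsto_const)
        show "AE x in ?M. cmod (indicator (\<Union>i<n. A i) x * f x) \<le> cmod (f x)" for n
          by (intro AE_I2) (auto simp: indicator_def)
        show "(\<lambda>x. indicator (\<Union>i<n. A i) x * f x) \<in> borel_measurable ?M" for n
          by (rule borel_measurable_integrable[OF indint]) (use A in auto)
        show "(\<lambda>x. indicator (\<Union>i. A i) x * f x) \<in> borel_measurable ?M"
          by (rule borel_measurable_integrable[OF indint]) (use A in auto)
      qed (use f in auto)
      ultimately show ?case
        by (simp add: LIMSEQ_const_iff)
    qed
  qed
  have any_set: "(\<integral>x. indicator A x * f x \<partial>?M) = 0 \<and> integrable ?M (\<lambda>x. indicator A x * f x)"
    if A: "A \<in> sets ?M" for A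
  proof -
    obtain S where S: "S \<in> sets borel" "AE x in ?M. x \<in> A \<longleftrightarrow> x \<in> S"
      using AE_lebesgue_on_borel_set[OF A] by auto
    have iS: "integrable ?M (\<lambda>x. indicator S x * f x)"
      using S(1) by (rule indint)
    have iA: "integrable ?M (\<lambda>x. indicator A x * f x)"
      using integrable_mult_indicator[OF A f] by (simp add: indicator_scaleR_eq_if indicator_times_eq_if)
    have "(\<integral>x. indicator A x * f x \<partial>?M) = (\<integral>x. indicator S x * f x \<partial>?M)"
      by (rule integral_cong_AE) (use S(2) iA iS in \<open>auto simp: indicator_def elim!: eventually_mono\<close>)
    with borel_set[OF S(1)] iA show ?thesis by simp
  qed
  have "AE x in ?M. Re (f x) = 0"
  proof (rule integral_indicator_zero_imp_AE_zero)
    fix A assume A: "A \<in> sets ?M"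
    have "(\<integral>x. indicator A x * Re (f x) \<partial>?M) = (\<integral>x. Re (indicator A x * f x) \<partial>?M)"
      by (intro Bochner_Integration.integral_cong) (auto simp: indicator_def)
    also have "\<dots> = 0"
      using any_set[OF A] by (simp add: integral_Re del: times_complex.sel)
    finally show "(\<integral>x. indicator A x * Re (f x) \<partial>?M) = 0" .
  qed (use f in auto)
  moreover have "AE x in ?M. Im (f x) = 0"
  proof (rule integral_indicator_zero_imp_AE_zero)
    fix A assume A: "A \<in> sets ?M"
    have "(\<integral>x. indicator A x * Im (f x) \<partial>?M) = (\<integral>x. Im (indicator A x * f x) \<partial>?M)"
      by (intro Bochner_Integration.integral_cong) (auto simp: indicator_def)
    also have "\<dots> = 0"
      using any_set[OF A] by (simp add: integral_Im del: times_complex.sel)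
    finally show "(\<integral>x. indicator A x * Im (f x) \<partial>?M) = 0" .
  qed (use f in auto)
  ultimately show ?thesis
    by eventually_elim (simp add: complex_eq_iff)
qed

section \<open>Fourier series of square-integrable functions\<close>

definition box_volume :: "'a::euclidean_space \<Rightarrow> 'a \<Rightarrow> real" where
  "box_volume a b = (\<Prod>i\<in>Basis. (b - a) \<bullet> i)"

definition fcoeff :: "'a::euclidean_space \<Rightarrow> 'a \<Rightarrow> ('a \<Rightarrow> complex) \<Rightarrow> ('a \<Rightarrow> int) \<Rightarrow> complex" where
  "fcoeff a b f k = (\<integral>x. f x * wave (- freq a b k) x \<partial>lebesgue_on (box a b)) / of_real (box_volume a b)"

text \<open>
  Extensional functions represent each frequency by exactly one index, which makes the sums over
  \<open>modes N\<close> free of repetitions and lets them factor over the coordinates.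
\<close>

definition modes :: "nat \<Rightarrow> ('a::euclidean_space \<Rightarrow> int) set" where
  "modes N = PiE Basis (\<lambda>_. {- int N..int N})"

definition fsum :: "'a::euclidean_space \<Rightarrow> 'a \<Rightarrow> ('a \<Rightarrow> complex) \<Rightarrow> nat \<Rightarrow> 'a \<Rightarrow> complex" where
  "fsum a b f N x = (\<Sum>k\<in>modes N. fcoeff a b f k * wave (freq a b k) x)"

lemma finite_modes: "finite (modes N)"
  by (simp add: modes_def finite_PiE)

lemma modes_mono: "M \<le> N \<Longrightarrow> modes M \<subseteq> modes N"
  unfolding modes_def by (intro PiE_mono) auto

lemma modes_subset: "modes N \<subseteq> extensional Basis"
  by (auto simp: modes_def PiE_def)

lemma extensional_in_modes:
  assumes "(k :: 'a::euclidean_space \<Rightarrow> int) \<in> extensional Basis"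
  obtains N where "k \<in> modes N"
proof
  define N where "N = (\<Sum>i\<in>(Basis :: 'a set). nat \<bar>k i\<bar>)"
  have "nat \<bar>k i\<bar> \<le> N" if "i \<in> Basis" for i
    unfolding N_def using that by (intro member_le_sum) auto
  then show "k \<in> modes N"
    using assms by (force simp: modes_def PiE_iff abs_le_iff)
qed

lemma Re_mult_cnj_self: "Re (z * cnj z) = (cmod z)\<^sup>2"
  unfolding complex_norm_square[symmetric] by (rule Re_complex_of_real)

lemma freq_restrict: "freq a b (restrict k Basis) = freq a b k"
  by (simp add: freq_def)

lemma wave_measurable_on: "wave w \<in> borel_measurable (lebesgue_on D)"
  by (intro measurable_restrict_space1 measurable_completion) simp

lemma wave_L2: "D \<in> lmeasurable \<Longrightarrow> wave w \<in> L2 D"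
  by (rule L2_bounded[of _ _ 1]) (auto simp: wave_measurable_on)

lemma fsum_L2: "fsum a b f N \<in> L2 (box a b)"
  unfolding fsum_def[abs_def] by (intro L2_sum L2_cmult wave_L2) simp

lemma fcoeff_add:
  assumes "f \<in> L2 (box a b)" "g \<in> L2 (box a b)"
  shows "fcoeff a b (\<lambda>x. f x + g x) k = fcoeff a b f k + fcoeff a b g k"
  using assms[THEN L2_mult_integrable, OF wave_L2]
  by (simp add: fcoeff_def distrib_right add_divide_distrib)

lemma fcoeff_cmult: "fcoeff a b (\<lambda>x. c * f x) k = c * fcoeff a b f k"
  by (simp add: fcoeff_def mult.assoc)

lemma fcoeff_zero: "fcoeff a b (\<lambda>x. 0) k = 0"
  by (simp add: fcoeff_def)

lemma fcoeff_sum: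
  assumes "\<And>i. i \<in> I \<Longrightarrow> f i \<in> L2 (box a b)"
  shows "fcoeff a b (\<lambda>x. \<Sum>i\<in>I. f i x) k = (\<Sum>i\<in>I. fcoeff a b (f i) k)"
  using assms
  by (induction I rule: infinite_finite_induct) (auto simp: fcoeff_zero fcoeff_add L2_sum)

context
  fixes a b :: "'a::euclidean_space"
  assumes ab: "\<And>i. i \<in> Basis \<Longrightarrow> a \<bullet> i < b \<bullet> i"
begin

lemma box_volume_pos: "0 < box_volume a b"
  unfolding box_volume_def by (intro prod_pos) (use ab in \<open>auto simp: inner_diff_left\<close>)

lemma measure_box: "measure (lebesgue_on (box a b)) (box a b) = box_volume a b"
proof -
  have "measure (lebesgue_on (box a b)) (box a b) = measure lborel (box a b)"
    by (simp add: measure_restrict_space)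
  also have "\<dots> = box_volume a b"
    unfolding box_volume_def using ab by (intro measure_lborel_box) (auto intro: less_imp_le)
  finally show ?thesis .
qed

lemma fcoeff_wave:
  assumes "k \<in> extensional Basis" "l \<in> extensional Basis"
  shows "fcoeff a b (wave (freq a b k)) l = (if k = l then 1 else 0)"
proof (cases "k = l")
  case True
  then show ?thesis
    using box_volume_pos by (simp add: fcoeff_def wave_mult measure_box scaleR_conv_of_real)
next
  case False
  then obtain i where "i \<in> Basis" "k i \<noteq> l i"
    using extensionalityI[OF assms] by auto
  then have "(\<integral>x. wave (freq a b (\<lambda>i. k i + - l i)) x \<partial>lebesgue_on (box a b)) = 0"
    by (intro integral_wave ab) auto
  then show ?thesis
    using False by (simp add: fcoeff_def wave_mult freq_uminus freq_add)
qed

lemma fcoeff_wave_sum: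
  assumes "finite A" "A \<subseteq> extensional Basis" "l \<in> extensional Basis"
  shows "fcoeff a b (\<lambda>x. \<Sum>k\<in>A. c k * wave (freq a b k) x) l = (if l \<in> A then c l else 0)"
proof -
  have "fcoeff a b (\<lambda>x. \<Sum>k\<in>A. c k * wave (freq a b k) x) l = (\<Sum>k\<in>A. c k * fcoeff a b (wave (freq a b k)) l)"
    by (simp add: fcoeff_sum L2_cmult wave_L2 fcoeff_cmult)
  also have "\<dots> = (\<Sum>k\<in>A. if k = l then c l else 0)"
    using assms by (intro sum.cong) (auto simp: fcoeff_wave subset_iff)
  also have "\<dots> = (if l \<in> A then c l else 0)"
    using assms(1) by simp
  finally show ?thesis .
qed

text \<open>
  With \<open>g\<close> itself a finite sum of waves this gives the norm of such a sum; with \<open>c\<close> the Fourier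
  coefficients of \<open>g\<close> it gives the Bessel inequality.
\<close>

lemma inner_wave_sum:
  assumes g: "g \<in> L2 (box a b)"
  shows "(\<integral>x. Re (g x * cnj (\<Sum>k\<in>A. c k * wave (freq a b k) x)) \<partial>lebesgue_on (box a b)) =
    box_volume a b * (\<Sum>k\<in>A. Re (fcoeff a b g k * cnj (c k)))"
proof -
  let ?M = "lebesgue_on (box a b)"
  have int: "integrable ?M (\<lambda>x. g x * wave (- freq a b k) x)" for k
    by (intro L2_mult_integrable g wave_L2) simp
  have "(\<integral>x. Re (g x * cnj (\<Sum>k\<in>A. c k * wave (freq a b k) x)) \<partial>?M) =
      (\<integral>x. Re (\<Sum>k\<in>A. cnj (c k) * (g x * wave (- freq a b k) x)) \<partial>?M)"
    by (intro Bochner_Integration.integral_cong refl arg_cong[of _ _ Re])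
       (simp add: cnj_wave sum_distrib_left mult.left_commute)
  also have "\<dots> = Re (\<integral>x. (\<Sum>k\<in>A. cnj (c k) * (g x * wave (- freq a b k) x)) \<partial>?M)"
    by (intro integral_Re Bochner_Integration.integrable_sum integrable_mult_right int)
  also have "(\<integral>x. (\<Sum>k\<in>A. cnj (c k) * (g x * wave (- freq a b k) x)) \<partial>?M) =
      (\<Sum>k\<in>A. cnj (c k) * (\<integral>x. g x * wave (- freq a b k) x \<partial>?M))"
    by (subst Bochner_Integration.integral_sum) (auto intro: int)
  also have "\<dots> = (\<Sum>k\<in>A. of_real (box_volume a b) * (fcoeff a b g k * cnj (c k)))"
    using box_volume_pos by (intro sum.cong) (auto simp: fcoeff_def)
  also have "Re \<dots> = box_volume a b * (\<Sum>k\<in>A. Re (fcoeff a b g k * cnj (c k)))"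
    by (simp add: sum_distrib_left[symmetric] del: times_complex.sel) simp
  finally show ?thesis .
qed

lemma L2norm_wave_sum:
  assumes "finite A" "A \<subseteq> extensional Basis"
  shows "(L2norm (box a b) (\<lambda>x. \<Sum>k\<in>A. c k * wave (freq a b k) x))\<^sup>2 = box_volume a b * (\<Sum>k\<in>A. (cmod (c k))\<^sup>2)"
proof -
  let ?u = "\<lambda>x. \<Sum>k\<in>A. c k * wave (freq a b k) x"
  have "?u \<in> L2 (box a b)"
    by (intro L2_sum L2_cmult wave_L2) simp
  have "(L2norm (box a b) ?u)\<^sup>2 = (\<integral>x. Re (?u x * cnj (?u x)) \<partial>lebesgue_on (box a b))"
    by (simp only: L2norm_power2 Re_mult_cnj_self)
  also have "\<dots> = box_volume a b * (\<Sum>k\<in>A. Re (fcoeff a b ?u k * cnj (c k)))"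
    by (rule inner_wave_sum) fact
  also have "\<dots> = box_volume a b * (\<Sum>k\<in>A. (cmod (c k))\<^sup>2)"
    using assms by (intro arg_cong2[of _ _ _ _ "(*)"] refl sum.cong) (auto simp: fcoeff_wave_sum subset_iff Re_mult_cnj_self simp del: times_complex.sel)
  finally show ?thesis .
qed

text \<open>
  The gap is the squared norm of \<open>g\<close> minus its partial Fourier sum.
\<close>

lemma Bessel:
  assumes g: "g \<in> L2 (box a b)"
  shows "box_volume a b * (\<Sum>k\<in>modes N. (cmod (fcoeff a b g k))\<^sup>2) \<le> (L2norm (box a b) g)\<^sup>2"
proof -
  let ?u = "\<lambda>x. \<Sum>k\<in>modes N. - fcoeff a b g k * wave (freq a b k) x"
  let ?s = "\<Sum>k\<in>modes N. (cmod (fcoeff a b g k))\<^sup>2"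
  have u: "?u \<in> L2 (box a b)"
    by (intro L2_sum L2_cmult wave_L2) simp
  have "0 \<le> (L2norm (box a b) (\<lambda>x. g x + ?u x))\<^sup>2"
    by simp
  also have "\<dots> = (L2norm (box a b) g)\<^sup>2
      + 2 * (box_volume a b * (\<Sum>k\<in>modes N. Re (fcoeff a b g k * cnj (- fcoeff a b g k))))
      + box_volume a b * (\<Sum>k\<in>modes N. (cmod (- fcoeff a b g k))\<^sup>2)"
    by (simp only: L2norm_add_power2[OF g u] inner_wave_sum[OF g] L2norm_wave_sum[OF finite_modes modes_subset])
  also have "(\<Sum>k\<in>modes N. Re (fcoeff a b g k * cnj (- fcoeff a b g k))) = - ?s"
    unfolding sum_negf[symmetric] by (intro sum.cong refl) (simp only: complex_cnj_minus mult_minus_right uminus_complex.sel Re_mult_cnj_self)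
  finally show ?thesis
    by simp
qed

end

context
  fixes a b :: "'a::euclidean_space"
  assumes ab: "\<And>i. i \<in> Basis \<Longrightarrow> a \<bullet> i < b \<bullet> i"
begin

text \<open>
  By the Bessel inequality a subsequence of the partial sums is rapidly Cauchy in \<open>L\<^sup>2\<close>, hence
  converges almost everywhere to some \<open>h\<close>.  The integrable majorant shows that \<open>h\<close> has the same Fourier
  coefficients as \<open>g\<close>, and completeness of the trigonometric system identifies the two.
\<close>

lemma fsum_AE_subsequence:
  assumes g: "g \<in> L2 (box a b)"
  obtains r where "strict_mono (r :: nat \<Rightarrow> nat)"
    "AE x in lebesgue_on (box a b). (\<lambda>j. fsum a b g (r j) x) \<longlonglongrightarrow> g x"
proof -
  let ?M = "lebesgue_on (box a b)"
  let ?c = "fcoeff a b g"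
  define s where "s N = (\<Sum>k\<in>modes N. (cmod (?c k))\<^sup>2)" for N
  have vol: "0 < box_volume a b"
    by (rule box_volume_pos[OF ab])
  have s_mono: "s M \<le> s N" if "M \<le> N" for M N
    unfolding s_def by (intro sum_mono2 finite_modes modes_mono that) auto
  have "s N \<le> (L2norm (box a b) g)\<^sup>2 / box_volume a b" for N
    using Bessel[OF ab g, of N] vol by (simp add: s_def field_simps)
  then have "convergent s"
    by (intro Bseq_mono_convergent BseqI'[of s "(L2norm (box a b) g)\<^sup>2 / box_volume a b"] allI impI s_mono)
       (auto simp: s_def sum_nonneg)
  then have "Cauchy s"
    by (simp add: Cauchy_convergent_iff)
  have "\<exists>N. \<forall>m\<ge>N. \<forall>n\<ge>N. dist (s m) (s n) < (1 / 4) ^ j / box_volume a b" for j :: nat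
    using \<open>Cauchy s\<close> vol by (intro metric_CauchyD) auto
  then obtain N where N: "\<And>j m n. m \<ge> N j \<Longrightarrow> n \<ge> N j \<Longrightarrow> dist (s m) (s n) < (1 / 4) ^ j / box_volume a b"
    by metis
  \<comment> \<open>The added \<open>j\<close> makes \<open>r\<close> strictly increasing while keeping it above the thresholds \<open>N j\<close>.\<close>
  define r where "r j = j + (\<Sum>i\<le>j. N i)" for j :: nat
  have r: "strict_mono r"
    by (simp add: r_def strict_mono_Suc_iff)
  have rN: "N j \<le> r j" for j
    unfolding r_def by (simp add: trans_le_add2 member_le_sum)
  have fast: "L2norm (box a b) (\<lambda>x. fsum a b g (r (Suc j)) x - fsum a b g (r j) x) \<le> (1 / 2) ^ j" for j
  proof -
    have le: "r j \<le> r (Suc j)"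
      using r by (simp add: strict_mono_less_eq)
    let ?A = "modes (r (Suc j)) - modes (r j)"
    have eq: "(\<lambda>x. fsum a b g (r (Suc j)) x - fsum a b g (r j) x) = (\<lambda>x. \<Sum>k\<in>?A. ?c k * wave (freq a b k) x)"
      unfolding fsum_def by (intro ext sum_diff[symmetric] finite_modes modes_mono le)
    have "?A \<subseteq> extensional Basis"
      using modes_subset[of "r (Suc j)"] by auto
    then have "(L2norm (box a b) (\<lambda>x. fsum a b g (r (Suc j)) x - fsum a b g (r j) x))\<^sup>2 =
        box_volume a b * (\<Sum>k\<in>?A. (cmod (?c k))\<^sup>2)"
      unfolding eq by (intro L2norm_wave_sum[OF ab] finite_Diff finite_modes)
    also have "(\<Sum>k\<in>?A. (cmod (?c k))\<^sup>2) = s (r (Suc j)) - s (r j)"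
      unfolding s_def by (intro sum_diff finite_modes modes_mono le)
    also have "\<dots> \<le> (1 / 4) ^ j / box_volume a b"
      using N[of j "r (Suc j)" "r j"] rN[of j] le by (simp add: dist_real_def)
    then have "box_volume a b * (s (r (Suc j)) - s (r j)) \<le> (1 / 4) ^ j"
      using vol by (simp add: field_simps)
    also have "(1 / 4 :: real) ^ j = ((1 / 2) ^ j)\<^sup>2"
      by (simp add: power2_eq_square flip: power_mult_distrib)
    finally show ?thesis
      by (rule power2_le_imp_le) simp
  qed
  obtain h w where h [measurable]: "h \<in> borel_measurable ?M" and w: "integrable ?M w"
    and bound: "\<And>j. AE x in ?M. cmod (fsum a b g (r j) x) \<le> w x"
    and lim: "AE x in ?M. (\<lambda>j. fsum a b g (r j) x) \<longlonglongrightarrow> h x"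
    using L2_fast_Cauchy_AE_convergent[of "box a b" "\<lambda>j. fsum a b g (r j)", OF _ fsum_L2 fast] by auto
  note [measurable] = fsum_L2[THEN L2_measurable] wave_measurable_on
  have h_int: "integrable ?M h"
    by (rule integrable_dominated_convergence[OF _ _ w lim bound]) measurable
  have coeff: "(\<integral>x. h x * wave (- freq a b k) x \<partial>?M) = (\<integral>x. g x * wave (- freq a b k) x \<partial>?M)"
    if k: "k \<in> extensional Basis" for k
  proof -
    have "(\<lambda>j. \<integral>x. fsum a b g (r j) x * wave (- freq a b k) x \<partial>?M) \<longlonglongrightarrow> (\<integral>x. h x * wave (- freq a b k) x \<partial>?M)"
    proof (rule integral_dominated_convergence[OF _ _ w])
      show "AE x in ?M. (\<lambda>j. fsum a b g (r j) x * wave (- freq a b k) x) \<longlonglongrightarrow> h x * wave (- freq a b k) x"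
        using lim by eventually_elim (intro tendsto_intros)
      show "AE x in ?M. cmod (fsum a b g (r j) x * wave (- freq a b k) x) \<le> w x" for j
        using bound[of j] by eventually_elim (simp add: norm_mult)
    qed measurable
    then have "(\<lambda>j. fcoeff a b (fsum a b g (r j)) k) \<longlonglongrightarrow> fcoeff a b h k"
      unfolding fcoeff_def using vol by (intro tendsto_intros) auto
    moreover have "\<forall>\<^sub>F j in sequentially. fcoeff a b (fsum a b g (r j)) k = ?c k"
    proof -
      obtain n where n: "k \<in> modes n"
        using extensional_in_modes[OF k] .
      have "fcoeff a b (fsum a b g (r j)) k = ?c k" if "j \<ge> n" for j
      proof -
        have "n \<le> r j"
          using that seq_suble[OF r, of j] by linarith
        then have "k \<in> modes (r j)"
          using n modes_mono by blast
        then show ?thesis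
          unfolding fsum_def[abs_def]
          by (simp add: fcoeff_wave_sum[OF ab finite_modes modes_subset k])
      qed
      then show ?thesis
        by (auto simp: eventually_sequentially)
    qed
    ultimately have "(\<lambda>j. ?c k) \<longlonglongrightarrow> fcoeff a b h k"
      by (rule Lim_transform_eventually)
    then have "fcoeff a b h k = ?c k"
      by (simp add: LIMSEQ_const_iff)
    then show ?thesis
      using vol by (simp add: fcoeff_def)
  qed
  have g_int: "integrable ?M g"
    by (rule L2_integrable[OF _ g]) simp
  have mult_int: "integrable ?M (\<lambda>x. u x * wave v x)" if "integrable ?M u" for u v
    by (rule Bochner_Integration.integrable_bound[OF that])
       (use borel_measurable_integrable[OF that] in \<open>auto simp: norm_mult\<close>)
  have "AE x in ?M. h x - g x = 0"
  proof (rule trig_complete)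
    show "integrable ?M (\<lambda>x. h x - g x)"
      using h_int g_int by (rule Bochner_Integration.integrable_diff)
    fix k :: "'a \<Rightarrow> int"
    have freq_eq: "freq a b k = - freq a b (restrict (\<lambda>i. - k i) Basis)"
      by (simp add: freq_restrict freq_uminus)
    have "(\<integral>x. (h x - g x) * wave (freq a b k) x \<partial>?M) =
        (\<integral>x. h x * wave (freq a b k) x \<partial>?M) - (\<integral>x. g x * wave (freq a b k) x \<partial>?M)"
      by (simp add: left_diff_distrib mult_int h_int g_int)
    also have "\<dots> = 0"
      unfolding freq_eq by (subst coeff) auto
    finally show "(\<integral>x. (h x - g x) * wave (freq a b k) x \<partial>?M) = 0" .
  qed
  with lim have "AE x in ?M. (\<lambda>j. fsum a b g (r j) x) \<longlonglongrightarrow> g x"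
    by eventually_elim simp
  with r show ?thesis
    by (rule that)
qed

text \<open>
  The Bessel inequality gives one direction; the other is Fatou's lemma along a subsequence of the
  partial sums that converges to \<open>g\<close> almost everywhere.
\<close>

lemma Parseval:
  assumes g: "g \<in> L2 (box a b)"
  shows "(\<lambda>N. box_volume a b * (\<Sum>k\<in>modes N. (cmod (fcoeff a b g k))\<^sup>2)) \<longlonglongrightarrow> (L2norm (box a b) g)\<^sup>2"
proof -
  let ?M = "lebesgue_on (box a b)"
  define s where "s N = box_volume a b * (\<Sum>k\<in>modes N. (cmod (fcoeff a b g k))\<^sup>2)" for N
  have vol: "0 < box_volume a b"
    by (rule box_volume_pos[OF ab])
  have s_mono: "s M \<le> s N" if "M \<le> N" for M N
    unfolding s_def using vol by (intro mult_left_mono sum_mono2 finite_modes modes_mono that) auto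
  have s_le: "s N \<le> (L2norm (box a b) g)\<^sup>2" for N
    unfolding s_def by (rule Bessel[OF ab g])
  have s_nonneg: "0 \<le> s N" for N
    unfolding s_def using vol by (intro mult_nonneg_nonneg sum_nonneg) auto
  have "convergent s"
    by (intro Bseq_mono_convergent BseqI'[of s "(L2norm (box a b) g)\<^sup>2"] allI impI s_mono)
       (simp add: s_nonneg s_le)
  then obtain T where T: "s \<longlonglongrightarrow> T"
    by (auto simp: convergent_def)
  have s_le_T: "s N \<le> T" for N
    by (rule incseq_le[OF _ T]) (auto simp: incseq_def s_mono)
  obtain r where lim: "AE x in ?M. (\<lambda>j. fsum a b g (r j) x) \<longlonglongrightarrow> g x"
    using fsum_AE_subsequence[OF g] by blast
  note [measurable] = fsum_L2[THEN L2_measurable] L2_measurable[OF g]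
  have norm_fsum: "(\<integral>\<^sup>+x. ennreal ((cmod (fsum a b g n x))\<^sup>2) \<partial>?M) = ennreal (s n)" for n
  proof -
    have "(\<integral>\<^sup>+x. ennreal ((cmod (fsum a b g n x))\<^sup>2) \<partial>?M) = ennreal ((L2norm (box a b) (fsum a b g n))\<^sup>2)"
      unfolding L2norm_power2 by (intro nn_integral_eq_integral L2_integrable_power2 fsum_L2) auto
    also have "(L2norm (box a b) (fsum a b g n))\<^sup>2 = s n"
      unfolding s_def fsum_def[abs_def] by (rule L2norm_wave_sum[OF ab finite_modes modes_subset])
    finally show ?thesis .
  qed
  have "ennreal ((L2norm (box a b) g)\<^sup>2) = (\<integral>\<^sup>+x. ennreal ((cmod (g x))\<^sup>2) \<partial>?M)"
    unfolding L2norm_power2 by (intro nn_integral_eq_integral[symmetric] L2_integrable_power2 g) auto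
  also have "\<dots> = (\<integral>\<^sup>+x. liminf (\<lambda>j. ennreal ((cmod (fsum a b g (r j) x))\<^sup>2)) \<partial>?M)"
  proof (rule nn_integral_cong_AE)
    show "AE x in ?M. ennreal ((cmod (g x))\<^sup>2) = liminf (\<lambda>j. ennreal ((cmod (fsum a b g (r j) x))\<^sup>2))"
      using lim
    proof eventually_elim
      case (elim x)
      then have "(\<lambda>j. ennreal ((cmod (fsum a b g (r j) x))\<^sup>2)) \<longlonglongrightarrow> ennreal ((cmod (g x))\<^sup>2)"
        by (intro tendsto_ennrealI tendsto_intros)
      then show ?case
        by (intro lim_imp_Liminf[symmetric]) auto
    qed
  qed
  also have "\<dots> \<le> liminf (\<lambda>j. \<integral>\<^sup>+x. ennreal ((cmod (fsum a b g (r j) x))\<^sup>2) \<partial>?M)"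
    by (rule nn_integral_liminf) measurable
  also have "\<dots> \<le> ennreal T"
    unfolding norm_fsum by (rule Liminf_le) (auto intro!: always_eventually ennreal_leI s_le_T)
  finally have "(L2norm (box a b) g)\<^sup>2 \<le> T"
    using order_trans[OF s_nonneg s_le_T] by (simp add: ennreal_le_iff)
  moreover have "T \<le> (L2norm (box a b) g)\<^sup>2"
    by (rule LIMSEQ_le_const2[OF T]) (auto intro: s_le)
  ultimately show ?thesis
    using T by (simp add: s_def[abs_def])
qed

text \<open>
  Polarization of the previous identity.
\<close>

lemma Parseval_inner:
  assumes u: "u \<in> L2 (box a b)" and v: "v \<in> L2 (box a b)"
  shows "(\<lambda>N. box_volume a b * (\<Sum>k\<in>modes N. Re (fcoeff a b u k * cnj (fcoeff a b v k)))) \<longlonglongrightarrow>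
    (\<integral>x. Re (u x * cnj (v x)) \<partial>lebesgue_on (box a b))"
proof -
  let ?P = "\<lambda>w N. box_volume a b * (\<Sum>k\<in>modes N. (cmod (fcoeff a b w k))\<^sup>2)"
  let ?n = "\<lambda>w. (L2norm (box a b) w)\<^sup>2"
  let ?w = "\<lambda>x. u x + v x"
  have polar: "Re (p * cnj q) = ((cmod (p + q))\<^sup>2 - (cmod p)\<^sup>2 - (cmod q)\<^sup>2) / 2" for p q
    by (simp only: cmod_power2) (simp add: power2_eq_square algebra_simps)
  have "(\<lambda>N. (?P ?w N - ?P u N - ?P v N) / 2) \<longlonglongrightarrow> (?n ?w - ?n u - ?n v) / 2"
    by (intro tendsto_intros Parseval u v L2_add) auto
  moreover have "(?P ?w N - ?P u N - ?P v N) / 2 =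
      box_volume a b * (\<Sum>k\<in>modes N. Re (fcoeff a b u k * cnj (fcoeff a b v k)))" for N
    by (simp only: polar fcoeff_add[OF u v] sum_divide_distrib[symmetric] sum_subtractf)
       (simp add: right_diff_distrib diff_divide_distrib)
  moreover have "(?n ?w - ?n u - ?n v) / 2 = (\<integral>x. Re (u x * cnj (v x)) \<partial>lebesgue_on (box a b))"
    using L2norm_add_power2[OF u v] by simp
  ultimately show ?thesis
    by simp
qed

end

section \<open>Periodic functions with two weak derivatives\<close>

lemma weak_deriv_L2:
  assumes "u \<in> H1 D" "i \<in> Basis"
  shows "weak_deriv D i u \<in> L2 D"
proof -
  have "\<exists>g. g \<in> L2 D \<and> is_weak_deriv D i u g"
    using assms by (auto simp: H1_def)
  then show ?thesis
    unfolding weak_deriv_def by (rule someI2_ex) auto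
qed

lemma H2_weak_deriv2_L2:
  assumes "u \<in> H2 D" "i \<in> Basis"
  shows "weak_deriv D i u \<in> L2 D" "weak_deriv D i (weak_deriv D i u) \<in> L2 D"
  using assms by (auto simp: H2_def intro: weak_deriv_L2)

lemma weak_laplacian_L2: "u \<in> H2 D \<Longrightarrow> weak_laplacian D u \<in> L2 D"
  unfolding weak_laplacian_def[abs_def] by (intro L2_sum H2_weak_deriv2_L2)

text \<open>
  The exponent \<open>- 2/3\<close> makes the terms decay like \<open>|n|\<^sup>-\<^sup>4\<^sup>/\<^sup>3\<close>, and it is what remains per coordinate when
  \<open>(1 + |w|\<^sup>2)\<^sup>-\<^sup>2\<close> is distributed over three coordinates.
\<close>

lemma inverse_power2_sum_bounded:
  fixes \<alpha> :: real
  assumes "0 < \<alpha>"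
  obtains C where "\<And>N. (\<Sum>n\<in>{- int N..int N}. (1 + (\<alpha> * of_int n)\<^sup>2) powr (-2/3)) \<le> C"
proof
  define q where "q n = (1 + (\<alpha> * of_int n)\<^sup>2) powr (-2/3)" for n :: int
  have q0: "0 \<le> q n" for n
    by (simp add: q_def)
  have "summable (\<lambda>n. q (int n))"
  proof (rule summable_comparison_test')
    show "summable (\<lambda>n. \<alpha> powr (-4/3) * real n powr (-4/3))"
      by (intro summable_mult) (simp add: summable_real_powr_iff)
    fix n :: nat assume n: "1 \<le> n"
    have "q (int n) \<le> ((\<alpha> * n)\<^sup>2) powr (-2/3)"
      unfolding q_def using assms n by (intro powr_mono2') auto
    also have "\<dots> = (\<alpha> * n) powr (-4/3)"
    proof -
      have "(\<alpha> * n)\<^sup>2 = (\<alpha> * n) powr 2"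
        using assms n by simp
      then show ?thesis
        by (simp only: powr_powr) simp
    qed
    also have "\<dots> = \<alpha> powr (-4/3) * real n powr (-4/3)"
      using assms by (simp add: powr_mult)
    finally show "norm (q (int n)) \<le> \<alpha> powr (-4/3) * real n powr (-4/3)"
      using q0 by simp
  qed
  then have le: "(\<Sum>n\<le>N. q (int n)) \<le> (\<Sum>n. q (int n))" for N
    by (intro sum_le_suminf) (auto simp: q0)
  fix N
  have "{- int N..int N} = int ` {..N} \<union> (\<lambda>n. - int n) ` {..N}"
  proof (intro equalityI subsetI)
    fix n assume "n \<in> {- int N..int N}"
    then show "n \<in> int ` {..N} \<union> (\<lambda>n. - int n) ` {..N}"
      by (cases "n \<ge> 0") (auto simp: image_iff intro: bexI[of _ "nat n"] bexI[of _ "nat (- n)"])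
  qed auto
  then have "(\<Sum>n\<in>{- int N..int N}. q n) \<le> (\<Sum>n\<in>int ` {..N}. q n) + (\<Sum>n\<in>(\<lambda>n. - int n) ` {..N}. q n)"
    using sum.union_inter[of "int ` {..N}" "(\<lambda>n. - int n) ` {..N}" q]
      sum_nonneg[of "int ` {..N} \<inter> (\<lambda>n. - int n) ` {..N}" q] q0 by simp
  also have "\<dots> = 2 * (\<Sum>n\<le>N. q (int n))"
    by (simp add: sum.reindex inj_on_def q_def)
  also have "\<dots> \<le> 2 * (\<Sum>n. q (int n))"
    using le[of N] by simp
  finally show "(\<Sum>n\<in>{- int N..int N}. (1 + (\<alpha> * of_int n)\<^sup>2) powr (-2/3)) \<le> 2 * (\<Sum>n. q (int n))"
    by (simp add: q_def)
qed

context
  fixes a b :: "'a::euclidean_space"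
  assumes ab: "\<And>i. i \<in> Basis \<Longrightarrow> a \<bullet> i < b \<bullet> i"
begin

text \<open>
  Periodicity of the traces is integration by parts, without boundary term, against smooth periodic
  functions; the test function is the conjugate plane wave.
\<close>

lemma fcoeff_weak_deriv:
  assumes u: "u \<in> H1 (box a b)" "periodic_traces a b u" and i: "i \<in> Basis"
  shows "fcoeff a b (weak_deriv (box a b) i u) k = \<i> * of_real (freq a b k \<bullet> i) * fcoeff a b u k"
proof -
  let ?M = "lebesgue_on (box a b)" and ?w = "- freq a b k"
  let ?g = "weak_deriv (box a b) i u"
  have w: "wave ?w \<in> L2 (box a b)"
    by (rule wave_L2) simp
  have int: "integrable ?M (\<lambda>x. u x * wave ?w x)" "integrable ?M (\<lambda>x. ?g x * wave ?w x)"
    using u i by (auto intro!: L2_mult_integrable w weak_deriv_L2 simp: H1_def)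
  have "box_periodic a b (wave ?w)"
    unfolding freq_uminus by (rule box_periodic_wave[OF ab])
  then have "0 = (\<integral>x. u x * partial_deriv i (wave ?w) x + ?g x * wave ?w x \<partial>?M)"
    using u(2) i smooth_wave[of ?w] by (simp add: periodic_traces_def)
  also have "\<dots> = (\<integral>x. (\<i> * of_real (?w \<bullet> i)) * (u x * wave ?w x) + ?g x * wave ?w x \<partial>?M)"
    by (simp only: partial_deriv_wave mult.left_commute mult.assoc)
  also have "\<dots> = (\<i> * of_real (?w \<bullet> i)) * (\<integral>x. u x * wave ?w x \<partial>?M) + (\<integral>x. ?g x * wave ?w x \<partial>?M)"
    using int by simp
  finally have "(\<integral>x. ?g x * wave ?w x \<partial>?M) = (\<i> * of_real (freq a b k \<bullet> i)) * (\<integral>x. u x * wave ?w x \<partial>?M)"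
    by (simp add: inner_minus_left)
  then show ?thesis
    by (simp add: fcoeff_def)
qed

lemma fcoeff_weak_laplacian:
  assumes "u \<in> H2 (box a b)" "periodic_bc a b u"
  shows "fcoeff a b (weak_laplacian (box a b) u) k = - of_real (\<Sum>i\<in>Basis. (freq a b k \<bullet> i)\<^sup>2) * fcoeff a b u k"
proof -
  let ?d = "\<lambda>i. weak_deriv (box a b) i"
  have "fcoeff a b (?d i (?d i u)) k = - of_real ((freq a b k \<bullet> i)\<^sup>2) * fcoeff a b u k" if i: "i \<in> Basis" for i
  proof -
    have "fcoeff a b (?d i (?d i u)) k =
        (\<i> * of_real (freq a b k \<bullet> i)) * ((\<i> * of_real (freq a b k \<bullet> i)) * fcoeff a b u k)"
      using assms i by (simp add: fcoeff_weak_deriv H2_def periodic_bc_def)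
    also have "\<dots> = (\<i> * \<i>) * (of_real (freq a b k \<bullet> i) * of_real (freq a b k \<bullet> i)) * fcoeff a b u k"
      by (simp only: ac_simps)
    finally show ?thesis
      by (simp add: power2_eq_square)
  qed
  then show ?thesis
    unfolding weak_laplacian_def[abs_def] using assms(1)
    by (simp add: fcoeff_sum H2_weak_deriv2_L2 sum_negf sum_distrib_right)
qed

text \<open>
  Compare Fourier coefficients: both sides are limits of
  \<open>- \<Sum>\<^sub>k |w\<^sub>k|\<^sup>2 |c\<^sub>k|\<^sup>2\<close> times the volume of the box.
\<close>

lemma periodic_Green:
  assumes u: "u \<in> H2 (box a b)" "periodic_bc a b u"
  shows "(\<integral>x. Re (u x * cnj (weak_laplacian (box a b) u x)) \<partial>lebesgue_on (box a b)) =
    - (\<Sum>i\<in>Basis. (L2norm (box a b) (weak_deriv (box a b) i u))\<^sup>2)"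
proof (rule LIMSEQ_unique)
  let ?c = "fcoeff a b u"
  have "u \<in> L2 (box a b)"
    using u by (simp add: H2_def H1_def)
  then show "(\<lambda>N. box_volume a b * (\<Sum>k\<in>modes N. Re (?c k * cnj (fcoeff a b (weak_laplacian (box a b) u) k)))) \<longlonglongrightarrow>
      (\<integral>x. Re (u x * cnj (weak_laplacian (box a b) u x)) \<partial>lebesgue_on (box a b))"
    by (intro Parseval_inner[OF ab] weak_laplacian_L2 u)
  have "(\<lambda>N. - (\<Sum>i\<in>Basis. box_volume a b * (\<Sum>k\<in>modes N. (cmod (fcoeff a b (weak_deriv (box a b) i u) k))\<^sup>2)))
      \<longlonglongrightarrow> - (\<Sum>i\<in>Basis. (L2norm (box a b) (weak_deriv (box a b) i u))\<^sup>2)"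
    by (intro tendsto_minus tendsto_sum Parseval[OF ab] H2_weak_deriv2_L2 u)
  moreover have "- (\<Sum>i\<in>Basis. box_volume a b * (\<Sum>k\<in>modes N. (cmod (fcoeff a b (weak_deriv (box a b) i u) k))\<^sup>2))
      = box_volume a b * (\<Sum>k\<in>modes N. Re (?c k * cnj (fcoeff a b (weak_laplacian (box a b) u) k)))" for N
  proof -
    have "(\<Sum>i\<in>Basis. \<Sum>k\<in>modes N. (cmod (fcoeff a b (weak_deriv (box a b) i u) k))\<^sup>2) =
        (\<Sum>k\<in>modes N. \<Sum>i\<in>Basis. (freq a b k \<bullet> i)\<^sup>2 * (cmod (?c k))\<^sup>2)"
      using u by (subst sum.swap) (simp add: fcoeff_weak_deriv H2_def periodic_bc_def norm_mult power_mult_distrib)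
    also have "\<dots> = (\<Sum>k\<in>modes N. - Re (?c k * cnj (fcoeff a b (weak_laplacian (box a b) u) k)))"
    proof (rule sum.cong[OF refl])
      fix k :: "'a \<Rightarrow> int"
      have "Re (?c k * cnj (fcoeff a b (weak_laplacian (box a b) u) k)) =
          Re (of_real (- (\<Sum>i\<in>Basis. (freq a b k \<bullet> i)\<^sup>2)) * (?c k * cnj (?c k)))"
        unfolding fcoeff_weak_laplacian[OF u]
        by (simp only: complex_cnj_mult complex_cnj_minus complex_cnj_complex_of_real of_real_minus ac_simps)
      also have "\<dots> = - (\<Sum>i\<in>Basis. (freq a b k \<bullet> i)\<^sup>2) * (cmod (?c k))\<^sup>2"
        by (simp only: Re_complex_of_real complex_norm_square[symmetric] of_real_mult[symmetric])
      finally show "(\<Sum>i\<in>Basis. (freq a b k \<bullet> i)\<^sup>2 * (cmod (?c k))\<^sup>2) =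
          - Re (?c k * cnj (fcoeff a b (weak_laplacian (box a b) u) k))"
        by (simp add: sum_distrib_right)
    qed
    finally show ?thesis
      by (simp add: sum_negf sum_distrib_left[symmetric] del: times_complex.sel)
  qed
  ultimately show "(\<lambda>N. box_volume a b * (\<Sum>k\<in>modes N. Re (?c k * cnj (fcoeff a b (weak_laplacian (box a b) u) k)))) \<longlonglongrightarrow>
      - (\<Sum>i\<in>Basis. (L2norm (box a b) (weak_deriv (box a b) i u))\<^sup>2)"
    by simp
qed

text \<open>
  Every factor \<open>1 + w\<^sub>i\<^sup>2\<close> is at most \<open>1 + |w|\<^sup>2\<close>, so in dimension at most three the product of all
  of them is at most \<open>(1 + |w|\<^sup>2)\<^sup>3\<close>.  Hence \<open>(1 + |w|\<^sup>2)\<^sup>-\<^sup>2\<close> is bounded by a product of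
  one-dimensional terms, whose sum over the lattice factors.
\<close>

lemma lattice_sum_bounded:
  assumes dim: "DIM('a) \<le> 3"
  obtains C where "\<And>N. (\<Sum>k\<in>modes N. 1 / (1 + (\<Sum>i\<in>Basis. (freq a b k \<bullet> i)\<^sup>2))\<^sup>2) \<le> C"
proof -
  define q where "q i n = (1 + (2 * pi / ((b - a) \<bullet> i) * of_int n)\<^sup>2) powr (-2/3)" for i :: 'a and n :: int
  have "\<exists>C. \<forall>N. (\<Sum>n\<in>{- int N..int N}. q i n) \<le> C" if i: "i \<in> Basis" for i
  proof -
    have "0 < 2 * pi / ((b - a) \<bullet> i)"
      using ab[OF i] by (simp add: inner_diff_left)
    then obtain C where "\<And>N. (\<Sum>n\<in>{- int N..int N}. (1 + (2 * pi / ((b - a) \<bullet> i) * of_int n)\<^sup>2) powr (-2/3)) \<le> C"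
      by (rule inverse_power2_sum_bounded) blast
    then show ?thesis
      unfolding q_def by blast
  qed
  then obtain C where C: "\<And>i N. i \<in> Basis \<Longrightarrow> (\<Sum>n\<in>{- int N..int N}. q i n) \<le> C i"
    by metis
  have le: "1 / (1 + (\<Sum>i\<in>Basis. (freq a b k \<bullet> i)\<^sup>2))\<^sup>2 \<le> (\<Prod>i\<in>Basis. q i (k i))" for k
  proof -
    define W where "W = 1 + (\<Sum>i\<in>Basis. (freq a b k \<bullet> i)\<^sup>2)"
    have W: "1 \<le> W"
      by (simp add: W_def sum_nonneg)
    have "(\<Prod>i\<in>Basis. 1 + (freq a b k \<bullet> i)\<^sup>2) \<le> (\<Prod>i\<in>(Basis :: 'a set). W)"
      unfolding W_def by (intro prod_mono) (auto intro!: member_le_sum)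
    also have "\<dots> = W ^ DIM('a)"
      by simp
    also have "\<dots> \<le> W ^ 3"
      using W dim by (intro power_increasing)
    finally have "(W ^ 3) powr (-2/3) \<le> (\<Prod>i\<in>Basis. 1 + (freq a b k \<bullet> i)\<^sup>2) powr (-2/3)"
      by (intro powr_mono2' prod_pos) (auto intro: add_pos_nonneg)
    also have "\<dots> = (\<Prod>i\<in>Basis. q i (k i))"
      by (subst prod_powr_distrib) (auto simp: q_def freq_inner intro!: prod.cong)
    also have "(W ^ 3) powr (-2/3) = W powr (-2)"
    proof -
      have "W ^ 3 = W powr 3"
        using W by simp
      then show ?thesis
        by (simp only: powr_powr) simp
    qed
    also have "\<dots> = 1 / W\<^sup>2"
      using W by (simp add: powr_minus_divide)
    finally show ?thesis
      unfolding W_def .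
  qed
  show ?thesis
  proof
    fix N
    have "(\<Sum>k\<in>modes N. 1 / (1 + (\<Sum>i\<in>Basis. (freq a b k \<bullet> i)\<^sup>2))\<^sup>2) \<le> (\<Sum>k\<in>modes N. \<Prod>i\<in>Basis. q i (k i))"
      by (intro sum_mono le)
    also have "\<dots> = (\<Prod>i\<in>Basis. \<Sum>n\<in>{- int N..int N}. q i n)"
      unfolding modes_def by (rule prod_sum_PiE[symmetric]) auto
    also have "\<dots> \<le> (\<Prod>i\<in>Basis. C i)"
      by (intro prod_mono conjI C sum_nonneg) (auto simp: q_def)
    finally show "(\<Sum>k\<in>modes N. 1 / (1 + (\<Sum>i\<in>Basis. (freq a b k \<bullet> i)\<^sup>2))\<^sup>2) \<le> (\<Prod>i\<in>Basis. C i)" .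
  qed
qed

text \<open>
  The Sobolev embedding into bounded functions.  The coefficients \<open>c\<^sub>k\<close> of \<open>u\<close> satisfy
  \<open>|c\<^sub>k| \<le> |(1 + |w\<^sub>k|\<^sup>2) c\<^sub>k|\<^sup>2 + (1 + |w\<^sub>k|\<^sup>2)\<^sup>-\<^sup>2\<close>; the first summands are Bessel sums of
  \<open>u - \<Delta>u \<in> L\<^sup>2\<close>.  So the partial Fourier sums are uniformly bounded, and so is their almost
  everywhere limit.
\<close>

lemma H2_periodic_bounded:
  assumes dim: "DIM('a) \<le> 3" and u: "u \<in> H2 (box a b)" "periodic_bc a b u"
  obtains B where "AE x in lebesgue_on (box a b). cmod (u x) \<le> B"
proof -
  let ?c = "fcoeff a b u"
  let ?f = "\<lambda>x. u x + (-1) * weak_laplacian (box a b) u x"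
  define W where "W k = 1 + (\<Sum>i\<in>Basis. (freq a b k \<bullet> i)\<^sup>2)" for k
  have W: "1 \<le> W k" for k
    by (simp add: W_def sum_nonneg)
  have uL2: "u \<in> L2 (box a b)"
    using u by (simp add: H2_def H1_def)
  have lap: "(\<lambda>x. (-1) * weak_laplacian (box a b) u x) \<in> L2 (box a b)"
    by (intro L2_cmult weak_laplacian_L2 u)
  have fL2: "?f \<in> L2 (box a b)"
    by (intro L2_add uL2 lap)
  have f: "fcoeff a b ?f k = of_real (W k) * ?c k" for k
    unfolding fcoeff_add[OF uL2 lap] fcoeff_cmult fcoeff_weak_laplacian[OF u]
    by (simp add: W_def distrib_right)
  obtain C where C: "\<And>N. (\<Sum>k\<in>modes N. 1 / (W k)\<^sup>2) \<le> C"
    using lattice_sum_bounded[OF dim] unfolding W_def by metis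
  define B where "B = (L2norm (box a b) ?f)\<^sup>2 / box_volume a b + C"
  have bound: "cmod (fsum a b u N x) \<le> B" for N x
  proof -
    have "cmod (fsum a b u N x) \<le> (\<Sum>k\<in>modes N. cmod (?c k))"
      unfolding fsum_def by (rule order_trans[OF norm_sum]) (simp add: norm_mult)
    also have "\<dots> \<le> (\<Sum>k\<in>modes N. (cmod (of_real (W k) * ?c k))\<^sup>2 + 1 / (W k)\<^sup>2)"
    proof (rule sum_mono)
      fix k :: "'a \<Rightarrow> int"
      have "2 * (W k * cmod (?c k)) * (1 / W k) \<le> (W k * cmod (?c k))\<^sup>2 + (1 / W k)\<^sup>2"
        by (rule sum_squares_bound)
      moreover have "2 * (W k * cmod (?c k)) * (1 / W k) = 2 * cmod (?c k)"
        using W[of k] by simp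
      moreover have "cmod (of_real (W k) * ?c k) = W k * cmod (?c k)"
        using W[of k] by (simp add: norm_mult)
      ultimately show "cmod (?c k) \<le> (cmod (of_real (W k) * ?c k))\<^sup>2 + 1 / (W k)\<^sup>2"
        using norm_ge_zero[of "?c k"] by (simp only: power_one_over)
    qed
    also have "\<dots> \<le> (L2norm (box a b) ?f)\<^sup>2 / box_volume a b + C"
      unfolding sum.distrib
    proof (rule add_mono[OF _ C])
      show "(\<Sum>k\<in>modes N. (cmod (of_real (W k) * ?c k))\<^sup>2) \<le> (L2norm (box a b) ?f)\<^sup>2 / box_volume a b"
        using Bessel[OF ab fL2, of N] box_volume_pos[OF ab] unfolding f
        by (simp add: pos_le_divide_eq mult.commute)
    qed
    finally show ?thesis by (simp add: B_def)
  qed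
  obtain r where "AE x in lebesgue_on (box a b). (\<lambda>j. fsum a b u (r j) x) \<longlonglongrightarrow> u x"
    using fsum_AE_subsequence[OF ab uL2] by blast
  then have "AE x in lebesgue_on (box a b). cmod (u x) \<le> B"
  proof eventually_elim
    case (elim x)
    show ?case
      by (rule LIMSEQ_le_const2[OF tendsto_norm[OF elim]]) (use bound in auto)
  qed
  then show ?thesis by (rule that)
qed

end

section \<open>The limit of the relaxed energy\<close>

theorem mainTheorem9:
  fixes a b :: "'a::euclidean_space"
    and S :: "real \<Rightarrow> ('a \<Rightarrow> complex) \<Rightarrow> 'a \<Rightarrow> complex"
    and V :: "'a \<Rightarrow> real" and \<beta> :: real and \<phi> :: "'a \<Rightarrow> complex"
  assumes "DIM('a) \<in> {1, 2, 3}"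
    and "\<forall>i\<in>Basis. a \<bullet> i < b \<bullet> i"
    and "periodic_heat_semigroup a b S"
    and "\<beta> > 0"
    and "V \<in> Linf (box a b)" and "AE x in lebesgue_on (box a b). 0 \<le> V x"
    and "\<phi> \<in> H2 (box a b)" and "periodic_bc a b \<phi>"
    and "L2norm (box a b) \<phi> = 1"
  shows "((\<lambda>\<tau>. relaxed_energy2 (box a b) S V \<beta> \<tau> \<phi>) \<longlongrightarrow> GP_energy (box a b) V \<beta> \<phi>) (at_right 0)"
proof -
  let ?D = "box a b" and ?M = "lebesgue_on (box a b)"
  let ?n = "\<lambda>u. (L2norm (box a b) u)\<^sup>2"
  note H2 = assms(7) and bc = assms(8)
  have ab: "\<And>i. i \<in> Basis \<Longrightarrow> a \<bullet> i < b \<bullet> i"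
    using assms(2) by blast
  interpret finite_measure ?M
    by (rule finite_measure_lebesgue_on) simp
  have \<phi>: "\<phi> \<in> L2 ?D"
    using H2 by (simp add: H2_def H1_def)
  note [measurable] = L2_measurable[OF \<phi>]
  have S: "S t \<phi> \<in> L2 ?D" if "t \<ge> 0" for t
    using assms(3) that \<phi> by (simp add: periodic_heat_semigroup_def C0_semigroup_def)

  \<comment> \<open>Boundedness of \<open>\<phi>\<close> makes the potential and quartic terms integrable.\<close>
  obtain B where B: "AE x in ?M. cmod (\<phi> x) \<le> B"
    by (rule H2_periodic_bounded[OF ab _ H2 bc]) (use assms(1) in auto)
  obtain K where K: "AE x in ?M. \<bar>V x\<bar> \<le> K" and [measurable]: "V \<in> borel_measurable ?M"
    using assms(5) by (auto simp: Linf_def)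
  have "integrable ?M (\<lambda>x. V x * (cmod (\<phi> x))\<^sup>2)"
  proof (rule integrable_const_bound[where B = "K * B\<^sup>2"])
    show "AE x in ?M. norm (V x * (cmod (\<phi> x))\<^sup>2) \<le> K * B\<^sup>2"
      using B K
    proof eventually_elim
      case (elim x)
      then show ?case
        by (auto simp: abs_mult intro!: mult_mono power_mono)
    qed
  qed measurable
  moreover have "integrable ?M (\<lambda>x. \<beta> / 2 * (cmod (\<phi> x)) ^ 4)"
  proof (rule integrable_mult_right, rule integrable_const_bound[where B = "B ^ 4"])
    show "AE x in ?M. norm ((cmod (\<phi> x)) ^ 4) \<le> B ^ 4"
      using B by eventually_elim (auto intro!: power_mono)
  qed measurable
  ultimately have pot: "integrable ?M (\<lambda>x. V x * (cmod (\<phi> x))\<^sup>2 + \<beta> / 2 * (cmod (\<phi> x)) ^ 4)"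
    by (rule Bochner_Integration.integrable_add)
  define P where "P = (\<integral>x. V x * (cmod (\<phi> x))\<^sup>2 + \<beta> / 2 * (cmod (\<phi> x)) ^ 4 \<partial>?M)"
  define G where "G = (\<Sum>i\<in>Basis. ?n (weak_deriv ?D i \<phi>))"

  have GP: "GP_energy ?D V \<beta> \<phi> = 1 / 2 * G + P"
  proof -
    have grad: "integrable ?M (\<lambda>x. (cmod (weak_deriv ?D i \<phi> x))\<^sup>2)" if "i \<in> Basis" for i
      by (intro L2_integrable_power2 H2_weak_deriv2_L2 H2 that)
    have "GP_energy ?D V \<beta> \<phi> = (\<integral>x. 1 / 2 * (\<Sum>i\<in>Basis. (cmod (weak_deriv ?D i \<phi> x))\<^sup>2) \<partial>?M) + P"
      unfolding GP_energy_def P_def add.assoc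
      by (intro Bochner_Integration.integral_add integrable_mult_right Bochner_Integration.integrable_sum grad pot)
    also have "(\<integral>x. 1 / 2 * (\<Sum>i\<in>Basis. (cmod (weak_deriv ?D i \<phi> x))\<^sup>2) \<partial>?M) = 1 / 2 * G"
      unfolding G_def L2norm_power2
      by (simp add: Bochner_Integration.integral_sum[OF grad])
    finally show ?thesis .
  qed

  define d where "d h = (?n (S h \<phi>) - ?n \<phi>) / h" for h
  have relaxed: "relaxed_energy2 ?D S V \<beta> \<tau> \<phi> = d (\<tau> / 2) / 4 - d (\<tau> / 4) / 2 + P" if \<tau>: "\<tau> > 0" for \<tau>
  proof -
    have int: "integrable ?M (\<lambda>x. (cmod (S (\<tau> / 2) \<phi> x))\<^sup>2)" "integrable ?M (\<lambda>x. (cmod (S (\<tau> / 4) \<phi> x))\<^sup>2)"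
      using \<tau> by (auto intro!: L2_integrable_power2 S)
    have "relaxed_energy2 ?D S V \<beta> \<tau> \<phi> = 3 / (2 * \<tau>) +
        ((\<integral>x. 1 / (2 * \<tau>) * ((cmod (S (\<tau> / 2) \<phi> x))\<^sup>2 - 4 * (cmod (S (\<tau> / 4) \<phi> x))\<^sup>2) \<partial>?M) + P)"
      unfolding relaxed_energy2_def P_def add.assoc
      by (intro arg_cong2[of _ _ _ _ "(+)"] refl Bochner_Integration.integral_add integrable_mult_right
          Bochner_Integration.integrable_diff int pot)
    also have "(\<integral>x. 1 / (2 * \<tau>) * ((cmod (S (\<tau> / 2) \<phi> x))\<^sup>2 - 4 * (cmod (S (\<tau> / 4) \<phi> x))\<^sup>2) \<partial>?M) =
        1 / (2 * \<tau>) * (?n (S (\<tau> / 2) \<phi>) - 4 * ?n (S (\<tau> / 4) \<phi>))"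
      unfolding L2norm_power2 using int by simp
    also have "3 / (2 * \<tau>) + (1 / (2 * \<tau>) * (?n (S (\<tau> / 2) \<phi>) - 4 * ?n (S (\<tau> / 4) \<phi>)) + P) =
        d (\<tau> / 2) / 4 - d (\<tau> / 4) / 2 + P"
      using \<tau> assms(9) by (simp add: d_def field_simps)
    finally show ?thesis .
  qed

  have "periodic_laplacian a b \<phi> (weak_laplacian ?D \<phi>)"
    using H2 bc by (simp add: periodic_laplacian_def)
  then have "generator ?D S \<phi> (weak_laplacian ?D \<phi>)"
    using assms(3) \<phi> weak_laplacian_L2[OF H2] by (simp add: periodic_heat_semigroup_def)
  then have d: "(d \<longlongrightarrow> - 2 * G) (at_right 0)"
    using L2norm_sq_derivative[OF _ \<phi> weak_laplacian_L2[OF H2], of S] S periodic_Green[OF ab H2 bc]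
    unfolding d_def G_def by simp
  have scale: "filterlim (\<lambda>\<tau>. \<tau> / c) (at_right 0) (at_right (0 :: real))" if "c > 0" for c :: real
  proof -
    have "((\<lambda>\<tau>. \<tau> / c) \<longlongrightarrow> 0 / c) (at_right 0)"
      using that by (intro tendsto_intros) auto
    moreover have "\<forall>\<^sub>F \<tau> in at_right 0. \<tau> / c \<in> {0<..} \<and> \<tau> / c \<noteq> 0"
      unfolding eventually_at_right_field using that by (auto intro!: exI[of _ 1])
    ultimately show ?thesis
      by (simp add: filterlim_at)
  qed
  have "((\<lambda>\<tau>. d (\<tau> / 2) / 4 - d (\<tau> / 4) / 2 + P) \<longlongrightarrow> (- 2 * G) / 4 - (- 2 * G) / 2 + P) (at_right 0)"
    by (intro tendsto_intros filterlim_compose[OF d] scale) auto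
  moreover have "(- 2 * G) / 4 - (- 2 * G) / 2 + P = GP_energy ?D V \<beta> \<phi>"
    by (simp add: GP)
  moreover have "\<forall>\<^sub>F \<tau> in at_right 0. d (\<tau> / 2) / 4 - d (\<tau> / 4) / 2 + P = relaxed_energy2 ?D S V \<beta> \<tau> \<phi>"
    unfolding eventually_at_right_field using relaxed by (auto intro!: exI[of _ 1])
  ultimately show ?thesis
    by (auto intro: Lim_transform_eventually)
qed

end
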